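(* Let $n\ge 3$ and let $L\subseteq\mathbb{R}^n$ be a centrally symmetric compact convex set. Then $L$ is $2$-reliable if and only if $L$ is $2$-decomposable.
   Context: All compact convex sets are nonempty. A compact convex set $L$ is centrally symmetric if $L$ and $-L$ are translates of each other. For a linear subspace $\xi$ of $\mathbb{R}^n$, $K_\xi$ denotes the orthogonal projection of $K$ onto $\xi$. A compact convex set $L\subseteq\mathbb{R}^n$ is $2$-reliable if, for every compact convex $K\subseteq\mathbb{R}^n$ such that $L_\xi$ contains a translate of $K_\xi$ for every $2$-dimensional linear subspace $\xi\subseteq\mathbb{R}^n$, the set $L$ contains a translate of $K$. The set $L$ is $2$-decomposable if there exist a direct sum decomposition into linear subspaces $\mathbb{R}^n=\xi_1\oplus\cdots\oplus\xi_m$ with $\dim\xi_i\le 2$ for each $i$, and compact convex sets $L_i\subseteq\xi_i$, such that $L=L_1+\cdots+L_m$ (Minkowski sum). *)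

theory Defs
  imports "HOL-Analysis.Analysis"
begin

definition compact_convex :: "'a::euclidean_space set \<Rightarrow> bool" where
  "compact_convex K \<longleftrightarrow> K \<noteq> {} \<and> compact K \<and> convex K"

definition contains_translate :: "'a::euclidean_space set \<Rightarrow> 'a set \<Rightarrow> bool" where
  "contains_translate L K \<longleftrightarrow> (\<exists>t. (+) t ` K \<subseteq> L)"

(* The point reflection -L must be written "uminus ` L": on sets, "- L" is the complement. *)
definition centrally_symmetric :: "'a::euclidean_space set \<Rightarrow> bool" where
  "centrally_symmetric L \<longleftrightarrow> (\<exists>t. uminus ` L = (+) t ` L)"

definition orth_proj :: "'a::euclidean_space set \<Rightarrow> 'a \<Rightarrow> 'a" where
  "orth_proj \<xi> x = (THE y. y \<in> \<xi> \<and> (\<forall>w\<in>\<xi>. orthogonal (x - y) w))"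

lemma orth_proj_unique_existence:
  fixes \<xi> :: "'a::euclidean_space set"
  assumes "subspace \<xi>"
  shows "\<exists>!y. y \<in> \<xi> \<and> (\<forall>w\<in>\<xi>. orthogonal (x - y) w)"
proof (rule ex_ex1I)
  show "\<exists>y. y \<in> \<xi> \<and> (\<forall>w\<in>\<xi>. orthogonal (x - y) w)"
    using orthogonal_subspace_decomp_exists[of \<xi> x] span_eq_iff[of \<xi>] assms
    by (metis add_diff_cancel_left')
next
  fix y z
  assume y: "y \<in> \<xi> \<and> (\<forall>w\<in>\<xi>. orthogonal (x - y) w)"
    and z: "z \<in> \<xi> \<and> (\<forall>w\<in>\<xi>. orthogonal (x - z) w)"
  have "y - z \<in> \<xi>"
    using y z assms by (simp add: subspace_diff)
  then have "(x - z) \<bullet> (y - z) = 0" "(x - y) \<bullet> (y - z) = 0"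
    using y z by (auto simp: orthogonal_def)
  then have "(y - z) \<bullet> (y - z) = 0"
    by (simp add: inner_diff_left)
  then show "y = z" by simp
qed

definition two_reliable :: "'a::euclidean_space set \<Rightarrow> bool" where
  "two_reliable L \<longleftrightarrow>
     (\<forall>K. compact_convex K \<longrightarrow>
        (\<forall>\<xi>. subspace \<xi> \<and> dim \<xi> = 2 \<longrightarrow>
              contains_translate (orth_proj \<xi> ` L) (orth_proj \<xi> ` K)) \<longrightarrow>
        contains_translate L K)"

(* The whole space is the (not necessarily orthogonal) internal direct sum of \<xi> 0, ..., \<xi> (m - 1). *)
definition direct_sum_decomposition :: "nat \<Rightarrow> (nat \<Rightarrow> 'a::euclidean_space set) \<Rightarrow> bool" where
  "direct_sum_decomposition m \<xi> \<longleftrightarrow>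
     (\<forall>i<m. subspace (\<xi> i)) \<and>
     (\<forall>x. \<exists>!v. v \<in> (\<Pi>\<^sub>E i\<in>{..<m}. \<xi> i) \<and> x = (\<Sum>i<m. v i))"

(* The sum of sets is the Minkowski sum of HOL-Library.Set_Algebras. *)
definition two_decomposable :: "'a::euclidean_space set \<Rightarrow> bool" where
  "two_decomposable L \<longleftrightarrow>
     (\<exists>m \<xi> M. direct_sum_decomposition m \<xi> \<and>
        (\<forall>i<m. dim (\<xi> i) \<le> 2 \<and> compact_convex (M i) \<and> M i \<subseteq> \<xi> i) \<and>
        L = (\<Sum>i<m. M i))"

end

theory Submission
  imports Defs
begin

text \<open>If \<open>L\<close> is a direct sum of planar pieces, each component of a translation vector can be read
  off from the shadow on a plane dual to the piece. Conversely, call \<open>u\<close> a regular normal if it spans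
  the normal cone at some boundary point. If four or more regular normals form a circuit with positive
  coefficients, a slight enlargement of the simplex of their contact points does not fit into \<open>L\<close>,
  although its shadows fit, since a plane contains only an independent subset of these normals and the
  contact points can be pushed into the interior simultaneously. For a centrally symmetric \<open>L\<close> signs are
  immaterial, so a 2-reliable \<open>L\<close> has only circuits of size at most three among its regular normals.
  Such circuits group a basis of normals into singletons and pairs so that every regular normal lies in
  the span of a group; as \<open>L\<close> is the intersection of its half-spaces with regular normals, it
  splits along the dual basis.\<close>

section \<open>Orthogonal projections and shadows\<close>

lemma orth_proj_in:
  fixes \<xi> :: "'a::euclidean_space set"
  assumes "subspace \<xi>"
  shows "orth_proj \<xi> x \<in> \<xi>"
  using theI'[OF orth_proj_unique_existence[OF assms, of x]] unfolding orth_proj_def by auto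

lemma orth_proj_orthogonal:
  fixes \<xi> :: "'a::euclidean_space set"
  assumes "subspace \<xi>" "w \<in> \<xi>"
  shows "(x - orth_proj \<xi> x) \<bullet> w = 0"
  using theI'[OF orth_proj_unique_existence[OF assms(1), of x]] assms(2)
  unfolding orth_proj_def orthogonal_def by auto

lemma orth_proj_eqI:
  fixes \<xi> :: "'a::euclidean_space set"
  assumes "subspace \<xi>" "y \<in> \<xi>" "\<And>w. w \<in> \<xi> \<Longrightarrow> (x - y) \<bullet> w = 0"
  shows "orth_proj \<xi> x = y"
  unfolding orth_proj_def
  by (rule the1_equality[OF orth_proj_unique_existence[OF assms(1)]])
    (use assms in \<open>auto simp: orthogonal_def\<close>)

text \<open>Two points have the same projection on \<open>\<xi>\<close> exactly when their
  difference is orthogonal to \<open>\<xi>\<close>, so shadow containment can be phrased by inner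
  products alone. The shift \<open>s\<close> may be any vector; only its projection matters.\<close>

lemma contains_translate_orth_proj_iff:
  fixes \<xi> :: "'a::euclidean_space set"
  assumes \<xi>: "subspace \<xi>"
  shows "contains_translate (orth_proj \<xi> ` L) (orth_proj \<xi> ` K) \<longleftrightarrow>
    (\<exists>s. \<forall>x\<in>K. \<exists>y\<in>L. \<forall>w\<in>\<xi>. (y - x - s) \<bullet> w = 0)" (is "?A \<longleftrightarrow> ?B")
proof
  assume ?A
  then obtain t where t: "(+) t ` orth_proj \<xi> ` K \<subseteq> orth_proj \<xi> ` L"
    unfolding contains_translate_def by blast
  have "\<exists>y\<in>L. \<forall>w\<in>\<xi>. (y - x - t) \<bullet> w = 0" if "x \<in> K" for x
  proof -
    obtain y where y: "y \<in> L" "t + orth_proj \<xi> x = orth_proj \<xi> y"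
      using t \<open>x \<in> K\<close> by blast
    have "(y - x - t) \<bullet> w = 0" if "w \<in> \<xi>" for w
    proof -
      have "y - x - t = (y - orth_proj \<xi> y) - (x - orth_proj \<xi> x)"
        using y(2) by (simp add: algebra_simps)
      then show ?thesis
        using orth_proj_orthogonal[OF \<xi> that] by (simp only: inner_diff_left[of "y - _"] diff_self)
    qed
    then show ?thesis using y(1) by blast
  qed
  then show ?B by blast
next
  assume ?B
  then obtain s where s: "\<And>x. x \<in> K \<Longrightarrow> \<exists>y\<in>L. \<forall>w\<in>\<xi>. (y - x - s) \<bullet> w = 0"
    by blast
  have "orth_proj \<xi> s + orth_proj \<xi> x \<in> orth_proj \<xi> ` L" if x: "x \<in> K" for x
  proof -
    obtain y where y: "y \<in> L" "\<And>w. w \<in> \<xi> \<Longrightarrow> (y - x - s) \<bullet> w = 0"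
      using s[OF x] by blast
    have "orth_proj \<xi> y = orth_proj \<xi> s + orth_proj \<xi> x"
    proof (rule orth_proj_eqI[OF \<xi>])
      show "orth_proj \<xi> s + orth_proj \<xi> x \<in> \<xi>"
        by (intro subspace_add \<xi> orth_proj_in)
      fix w assume w: "w \<in> \<xi>"
      have "y - (orth_proj \<xi> s + orth_proj \<xi> x)
          = (y - x - s) + (s - orth_proj \<xi> s) + (x - orth_proj \<xi> x)"
        by (simp add: algebra_simps)
      then show "(y - (orth_proj \<xi> s + orth_proj \<xi> x)) \<bullet> w = 0"
        using y(2)[OF w] orth_proj_orthogonal[OF \<xi> w] by (simp only: inner_add_left)
    qed
    then show ?thesis using y(1) by (metis imageI)
  qed
  then show ?A unfolding contains_translate_def by blast
qed

text \<open>Shadows are tested on subspaces of dimension exactly 2, so a set of smaller rank has to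
  be padded to a plane.\<close>

lemma orthonormal_pair_span_superset:
  fixes S :: "'a::euclidean_space set"
  assumes "dim S \<le> 2" "DIM('a) \<ge> 2"
  obtains a b :: 'a where "norm a = 1" "norm b = 1" "a \<bullet> b = 0" "S \<subseteq> span {a, b}"
    "dim (span {a, b}) = 2"
proof -
  obtain B where B: "B \<subseteq> S" "independent B" "S \<subseteq> span B" "card B = dim S"
    using basis_exists[of S] by metis
  obtain D where D: "B \<subseteq> D" "independent D" "span D = UNIV"
    using maximal_independent_subset_extend[OF subset_UNIV B(2)] by (metis top.extremum_uniqueI)
  have "card D = DIM('a)"
    using dim_eq_card_independent[OF D(2)] dim_span[of D] D(3) by simp
  then obtain E where E: "B \<subseteq> E" "E \<subseteq> D" "card E = 2"
    using exists_subset_between[of B 2 D] B(4) assms D(1) independent_bound[OF D(2)]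
    \<open>card D = DIM('a)\<close> by auto
  have "independent E" using D(2) E(2) independent_mono by blast
  then have "dim (span E) = 2" using E(3) by (simp add: dim_eq_card_independent)
  then obtain F where F: "pairwise orthogonal F" "\<And>x. x \<in> F \<Longrightarrow> norm x = 1"
     "card F = 2" "span F = span E"
    using orthonormal_basis_subspace[OF subspace_span[of E]] \<open>dim (span E) = 2\<close> by (smt (verit))
  obtain a b where ab: "F = {a, b}" "a \<noteq> b" using F(3) card_2_iff by metis
  have sp: "span {a, b} = span E" using F(4) ab(1) by simp
  show thesis
  proof (rule that)
    show "norm a = 1" "norm b = 1" using F(2) ab(1) by auto
    show "a \<bullet> b = 0" using F(1) ab by (simp add: pairwise_def orthogonal_def)
    show "S \<subseteq> span {a, b}" unfolding sp using B(3) span_mono[OF E(1)] by blast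
    show "dim (span {a, b}) = 2" unfolding sp by fact
  qed
qed

section \<open>From decomposability to reliability\<close>

text \<open>The component of a vector in \<open>\<xi> i\<close> is determined by its inner products
  with at most two vectors, so one planar shadow yields the shift for that summand. The shifts of
  different components can be chosen independently and added.\<close>

lemma two_decomposable_imp_two_reliable:
  fixes L :: "'a::euclidean_space set"
  assumes n: "DIM('a) \<ge> 2" and "two_decomposable L"
  shows "two_reliable L"
  unfolding two_reliable_def
proof (intro allI impI)
  fix K :: "'a set"
  assume shadows: "\<forall>\<xi>. subspace \<xi> \<and> dim \<xi> = 2 \<longrightarrow>
    contains_translate (orth_proj \<xi> ` L) (orth_proj \<xi> ` K)"
  obtain m :: nat and \<xi> M :: "nat \<Rightarrow> 'a set" where sub: "\<And>i. i < m \<Longrightarrow> subspace (\<xi> i)"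
    and ex1: "\<And>x. \<exists>!v. v \<in> (\<Pi>\<^sub>E i\<in>{..<m}. \<xi> i) \<and> x = (\<Sum>i<m. v i)"
    and dim: "\<And>i. i < m \<Longrightarrow> dim (\<xi> i) \<le> 2"
    and M: "\<And>i. i < m \<Longrightarrow> M i \<subseteq> \<xi> i" and L: "L = (\<Sum>i<m. M i)"
  proof -
    obtain m \<xi> M where *: "direct_sum_decomposition m \<xi>"
      "\<forall>i<m. dim (\<xi> i) \<le> 2 \<and> compact_convex (M i) \<and> M i \<subseteq> \<xi> i" "L = (\<Sum>i<m. M i)"
      using assms(2) unfolding two_decomposable_def by blast
    show thesis
      by (rule that[of m \<xi> M]) (use * in \<open>simp_all add: direct_sum_decomposition_def\<close>)
  qed
  have L_iff: "y \<in> L \<longleftrightarrow> (\<exists>v. (\<forall>i<m. v i \<in> M i) \<and> y = (\<Sum>i<m. v i))" for y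
    unfolding L set_sum_alt[OF finite_lessThan] by auto
  define \<pi> where "\<pi> x = (THE v. v \<in> (\<Pi>\<^sub>E i\<in>{..<m}. \<xi> i) \<and> x = (\<Sum>i<m. v i))" for x
  have \<pi>_in: "\<pi> x i \<in> \<xi> i" if "i < m" for x i
    using theI'[OF ex1[of x]] that unfolding \<pi>_def by auto
  have \<pi>_sum: "(\<Sum>i<m. \<pi> x i) = x" for x
    using theI'[OF ex1[of x]] unfolding \<pi>_def by auto
  have \<pi>_eq: "\<pi> x i = v i" if "\<And>i. i < m \<Longrightarrow> v i \<in> \<xi> i" "x = (\<Sum>i<m. v i)" "i < m" for x v i
  proof -
    have "\<pi> x = restrict v {..<m}"
      unfolding \<pi>_def by (rule the1_equality[OF ex1]) (use that in auto)
    then show ?thesis using that(3) by simp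
  qed
  have lin: "linear (\<lambda>x. \<pi> x i)" if i: "i < m" for i
  proof (rule linearI)
    show "\<pi> (x + y) i = \<pi> x i + \<pi> y i" for x y
      by (rule \<pi>_eq[OF _ _ i]) (auto simp: \<pi>_in sub subspace_add sum.distrib \<pi>_sum)
    show "\<pi> (c *\<^sub>R x) i = c *\<^sub>R \<pi> x i" for c x
      by (rule \<pi>_eq[OF _ _ i]) (auto simp: \<pi>_in sub subspace_scale scaleR_sum_right[symmetric] \<pi>_sum)
  qed
  have "\<exists>s. \<forall>x\<in>K. s + \<pi> x i \<in> M i" if i: "i < m" for i
  proof -
    obtain B where B: "card B = dim (\<xi> i)" "independent B" "span B = \<xi> i"
      using orthonormal_basis_subspace[OF sub[OF i]] by metis
    \<comment> \<open>The sum need not be orthogonal, so the plane to use is not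
      \<open>\<xi> i\<close> itself: \<open>\<pi> z i \<bullet> e\<close> is the inner product of
      \<open>z\<close> with the adjoint image of \<open>e\<close>.\<close>
    define A where "A = adjoint (\<lambda>x. \<pi> x i) ` B"
    have "finite B" using B(2) independent_bound by blast
    then have "dim A \<le> 2"
      unfolding A_def using dim_le_card'[of "adjoint (\<lambda>x. \<pi> x i) ` B"] B(1) dim[OF i]
      by (metis card_image_le finite_imageI le_trans)
    then obtain a b where ab: "A \<subseteq> span {a, b}" "dim (span {a, b}) = 2"
      using orthonormal_pair_span_superset n by metis
    obtain s where s: "\<And>x. x \<in> K \<Longrightarrow> \<exists>y\<in>L. \<forall>w\<in>span {a, b}. (y - x - s) \<bullet> w = 0"
      using shadows ab(2) contains_translate_orth_proj_iff[of "span {a, b}" L K] subspace_span by blast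
    have "\<pi> s i + \<pi> x i \<in> M i" if x: "x \<in> K" for x
    proof -
      obtain y where y: "y \<in> L" "\<And>w. w \<in> span {a, b} \<Longrightarrow> (y - x - s) \<bullet> w = 0"
        using s[OF x] by blast
      have "\<pi> (y - x - s) i \<bullet> e = 0" if "e \<in> B" for e
        using y(2)[of "adjoint (\<lambda>x. \<pi> x i) e"] that ab(1) adjoint_works[OF lin[OF i]]
        unfolding A_def by auto
      then have "\<pi> (y - x - s) i \<bullet> e = 0" if "e \<in> span B" for e
        using that orthogonal_to_span[of e B "\<pi> (y - x - s) i"]
        by (auto simp: orthogonal_def inner_commute)
      then have "\<pi> (y - x - s) i = 0"
        using \<pi>_in[OF i] B(3) inner_eq_zero_iff by blast
      then have "\<pi> y i = \<pi> s i + \<pi> x i"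
        unfolding linear_diff[OF lin[OF i]] by (simp add: algebra_simps)
      moreover obtain v where v: "\<And>j. j < m \<Longrightarrow> v j \<in> M j" "y = (\<Sum>j<m. v j)"
        using y(1) unfolding L_iff by blast
      have "\<pi> y i = v i"
        by (rule \<pi>_eq[OF _ v(2) i]) (use v(1) M in blast)
      then have "\<pi> y i \<in> M i" using v(1) i by simp
      ultimately show ?thesis by simp
    qed
    then show ?thesis by blast
  qed
  then obtain s where s: "\<And>i x. i < m \<Longrightarrow> x \<in> K \<Longrightarrow> s i + \<pi> x i \<in> M i"
    by metis
  have "(\<Sum>i<m. s i) + x \<in> L" if "x \<in> K" for x
    unfolding L_iff using s[OF _ that]
    by (intro exI[of _ "\<lambda>i. s i + \<pi> x i"]) (auto simp: sum.distrib \<pi>_sum)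
  then show "contains_translate L K"
    unfolding contains_translate_def by blast
qed

section \<open>Regular normals of closed convex sets\<close>

definition regular_normal :: "'a::euclidean_space set \<Rightarrow> 'a \<Rightarrow> 'a \<Rightarrow> bool" where
  "regular_normal C x u \<longleftrightarrow> x \<in> C \<and> u \<noteq> 0 \<and> (\<forall>y\<in>C. u \<bullet> y \<le> u \<bullet> x) \<and>
     (\<forall>v. (\<forall>y\<in>C. v \<bullet> y \<le> v \<bullet> x) \<longrightarrow> (\<exists>c\<ge>0. v = c *\<^sub>R u))"

text \<open>A separation from the interior extends to all of \<open>C\<close>, since a closed convex
  set with nonempty interior is the closure of its interior.\<close>

lemma separate_from_interior:
  fixes C :: "'a::euclidean_space set"
  assumes C: "closed C" "convex C" "interior C \<noteq> {}"
    and T: "convex T" "T \<noteq> {}" "interior C \<inter> T = {}"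
  obtains v where "v \<noteq> 0" "\<And>y z. y \<in> C \<Longrightarrow> z \<in> T \<Longrightarrow> v \<bullet> y \<le> v \<bullet> z"
proof -
  obtain v b where v: "v \<noteq> 0" "\<forall>x\<in>interior C. v \<bullet> x \<le> b" "\<forall>x\<in>T. v \<bullet> x \<ge> b"
    using separating_hyperplane_sets[OF convex_interior[OF C(2)] T(1) C(3) T(2,3)] by blast
  have "closure (interior C) \<subseteq> {x. v \<bullet> x \<le> b}"
    by (rule closure_minimal) (use v in \<open>auto simp: closed_halfspace_le\<close>)
  then have "C \<subseteq> {x. v \<bullet> x \<le> b}"
    using convex_closure_interior[OF C(2,3)] closure_closed[OF C(1)] by simp
  then show thesis using that[of v] v(1,3) by force
qed

lemma interior_support_strict:
  fixes C :: "'a::euclidean_space set"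
  assumes "p \<in> interior C" "u \<noteq> 0" "\<And>y. y \<in> C \<Longrightarrow> u \<bullet> y \<le> h"
  shows "u \<bullet> p < h"
proof -
  obtain e where e: "e > 0" "cball p e \<subseteq> C"
    using assms(1) mem_interior_cball by blast
  have "p + (e / norm u) *\<^sub>R u \<in> cball p e"
    using e(1) assms(2) by (simp add: dist_norm)
  then have "u \<bullet> (p + (e / norm u) *\<^sub>R u) \<le> h" using e assms(3) by blast
  moreover have "(e / norm u) * (u \<bullet> u) > 0" using e assms(2) by simp
  ultimately show ?thesis by (simp add: inner_add_right)
qed

text \<open>Any functional supporting \<open>C\<close> at \<open>q\<close> also supports the
  inscribed ball there, and the ball has only one outer normal direction at \<open>q\<close>. Some
  functional does support \<open>C\<close> at \<open>q\<close> because \<open>q\<close> is not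
  interior.\<close>

lemma regular_normal_at_touching_ball:
  fixes C :: "'a::euclidean_space set"
  assumes C: "closed C" "convex C" and r: "r > 0" and ball: "cball c r \<subseteq> C"
    and q: "q \<in> cball c r" "q \<notin> interior C"
  shows "regular_normal C q (q - c)" and "norm (q - c) = r"
proof -
  have int: "interior C \<noteq> {}"
    using interior_mono[OF ball] r by force
  \<comment> \<open>The point of the ball farthest in direction \<open>v\<close> gives
    \<open>r * norm v \<le> v \<bullet> (q - c)\<close>. Cauchy-Schwarz gives the reverse bound, and
    the equality case makes \<open>v\<close> and \<open>q - c\<close> parallel.\<close>
  have *: "v = (norm v / r) *\<^sub>R (q - c) \<and> norm (q - c) = r"
    if v: "v \<noteq> 0" "\<And>y. y \<in> C \<Longrightarrow> v \<bullet> y \<le> v \<bullet> q" for v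
  proof -
    have "c + (r / norm v) *\<^sub>R v \<in> cball c r" using r v(1) by (simp add: dist_norm)
    then have "v \<bullet> (c + (r / norm v) *\<^sub>R v) \<le> v \<bullet> q" using ball v(2) by blast
    moreover have "v \<bullet> ((r / norm v) *\<^sub>R v) = r * norm v"
      using v(1) by (simp add: dot_square_norm power2_eq_square)
    ultimately have 1: "r * norm v \<le> v \<bullet> (q - c)"
      by (simp add: inner_add_right inner_diff_right)
    have 2: "v \<bullet> (q - c) \<le> norm v * norm (q - c)" by (rule norm_cauchy_schwarz)
    have 3: "norm (q - c) \<le> r" using q(1) by (simp add: dist_norm norm_minus_commute)
    have "r * norm v \<le> norm (q - c) * norm v" using 1 2 by (simp add: mult.commute)
    then have 4: "norm (q - c) = r" using 3 v(1) by simp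
    then have "v \<bullet> (q - c) = norm v * norm (q - c)" using 1 2 by (simp add: mult.commute)
    then have "norm v *\<^sub>R (q - c) = r *\<^sub>R v" using norm_cauchy_schwarz_eq[of v "q - c"] 4 by simp
    then have "(1 / r) *\<^sub>R (norm v *\<^sub>R (q - c)) = (1 / r) *\<^sub>R (r *\<^sub>R v)" by simp
    then show ?thesis using r 4 by simp
  qed
  have disj: "interior C \<inter> {q} = {}" using q(2) by simp
  obtain v where v: "v \<noteq> 0" "\<And>y z. y \<in> C \<Longrightarrow> z \<in> {q} \<Longrightarrow> v \<bullet> y \<le> v \<bullet> z"
    using separate_from_interior[OF C int convex_singleton insert_not_empty disj] by blast
  have v': "\<And>y. y \<in> C \<Longrightarrow> v \<bullet> y \<le> v \<bullet> q" using v(2) by blast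
  note vq = *[OF v(1) v']
  then show nr: "norm (q - c) = r" by blast
  have "(q - c) \<bullet> y \<le> (q - c) \<bullet> q" if "y \<in> C" for y
  proof -
    have "(norm v / r) * ((q - c) \<bullet> y) \<le> (norm v / r) * ((q - c) \<bullet> q)"
      using v'[OF that] vq by (metis inner_scaleR_left)
    then show ?thesis using r v(1) by (simp add: divide_simps)
  qed
  moreover have "\<exists>k\<ge>0. w = k *\<^sub>R (q - c)" if "\<forall>y\<in>C. w \<bullet> y \<le> w \<bullet> q" for w
  proof (cases "w = 0")
    case True
    then show ?thesis by (intro exI[of _ 0]) auto
  next
    case False
    then show ?thesis using *[of w] that r by (intro exI[of _ "norm w / r"]) auto
  qed
  ultimately show "regular_normal C q (q - c)"
    unfolding regular_normal_def using q ball nr r by auto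
qed

text \<open>A small ball inside \<open>C\<close> is pushed towards \<open>y\<close> until it touches the boundary of \<open>C\<close>.\<close>

lemma regular_normal_separates:
  fixes C :: "'a::euclidean_space set"
  assumes C: "closed C" "convex C" "interior C \<noteq> {}" and y: "y \<notin> C"
  obtains x u where "regular_normal C x u" "u \<bullet> x < u \<bullet> y"
proof -
  obtain z R where R: "R > 0" "cball z R \<subseteq> C"
    using C(3) mem_interior_cball by blast
  define p where "p s = z + s *\<^sub>R (y - z)" for s :: real
  have cont: "continuous_on UNIV p" unfolding p_def by (intro continuous_intros)
  have p0: "p 0 = z" and p1: "p 1 = y" by (auto simp: p_def)
  \<comment> \<open>\<open>A r\<close> collects the parameters \<open>s\<close> for which the ball
    of radius \<open>r\<close> around \<open>p s\<close> fits into \<open>C\<close>. Writing it as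
    an intersection of preimages makes it compact.\<close>
  define A where "A r = {0..1} \<inter> (\<Inter>v\<in>cball 0 r. (\<lambda>s. p s + v) -` C)" for r :: real
  have A_iff: "s \<in> A r \<longleftrightarrow> 0 \<le> s \<and> s \<le> 1 \<and> cball (p s) r \<subseteq> C" for s r
  proof -
    have ball: "cball (p s) r = (+) (p s) ` cball 0 r" by (simp add: cball_translation)
    have "cball (p s) r \<subseteq> C \<longleftrightarrow> (\<forall>v\<in>cball 0 r. p s + v \<in> C)" unfolding ball by blast
    then show ?thesis unfolding A_def by auto
  qed
  have comp: "compact (A r)" for r
    unfolding A_def using C(1)
    by (intro compact_Int_closed closed_INT ballI closed_vimage)
       (auto intro!: continuous_intros cont[THEN continuous_on_subset] simp: p_def)
  have "z \<in> C" using R by (meson centre_in_cball less_imp_le subsetD)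
  then have "A 0 \<noteq> {}" using A_iff[of 0 0] p0 by auto
  then obtain \<sigma> where \<sigma>: "\<sigma> \<in> A 0" "\<And>s. s \<in> A 0 \<Longrightarrow> s \<le> \<sigma>"
    using compact_attains_sup[OF comp] by blast
  have "\<sigma> \<noteq> 1" using \<sigma>(1) A_iff[of 1 0] y p1 by auto
  then have \<sigma>1: "\<sigma> < 1" "0 \<le> \<sigma>" using \<sigma>(1) A_iff by auto
  \<comment> \<open>The radius is tuned so that the final estimate sets a gain of at least
    \<open>2 * r * r\<close> against a loss of \<open>r * r\<close>.\<close>
  define r where "r = (1 - \<sigma>) * R / 3"
  have "(1 - \<sigma>) * R \<le> 1 * R" by (rule mult_right_mono) (use \<sigma>1 R in auto)
  then have r: "r > 0" "3 * r \<le> R" "3 * r = (1 - \<sigma>) * R"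
    using \<sigma>1 R unfolding r_def by auto
  have "cball z r \<subseteq> cball z R" using r by (intro subset_cball) auto
  then have "0 \<in> A r" using A_iff[of 0 r] R p0 by auto
  then obtain s where s: "s \<in> A r" "\<And>s'. s' \<in> A r \<Longrightarrow> s' \<le> s"
    using compact_attains_sup[OF comp] by (metis empty_iff)
  have ball: "cball (p s) r \<subseteq> C" and s01: "0 \<le> s" using s(1) A_iff by auto
  have "s \<in> A 0" using s(1) A_iff[of s r] A_iff[of s 0] r(1) by auto
  then have s\<sigma>: "s \<le> \<sigma>" using \<sigma>(2) by blast
  \<comment> \<open>Otherwise, by compactness, the ball keeps a distance \<open>e\<close> from the
    complement of the interior and can be pushed on by a small \<open>d\<close>, against the
    maximality of \<open>s\<close>.\<close>
  have "\<not> cball (p s) r \<subseteq> interior C"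
  proof
    assume "cball (p s) r \<subseteq> interior C"
    then obtain e where e: "e > 0" "(\<Union>x\<in>cball (p s) r. ball x e) \<subseteq> interior C"
      using compact_subset_open_imp_ball_epsilon_subset[OF compact_cball open_interior] by metis
    define d where "d = min (1 - s) (e / (2 * (norm (y - z) + 1)))"
    have d: "d > 0" "d \<le> 1 - s" using e(1) s\<sigma> \<sigma>1 by (auto simp: d_def add_nonneg_pos)
    have "d * norm (y - z) \<le> d * (norm (y - z) + 1)" using d by simp
    also have "\<dots> \<le> e / (2 * (norm (y - z) + 1)) * (norm (y - z) + 1)"
      by (rule mult_right_mono) (auto simp: d_def)
    also have "\<dots> = e / 2"
      by (simp add: field_simps add_nonneg_eq_0_iff)
    finally have de: "d * norm (y - z) < e" using e(1) by simp
    have "cball (p (s + d)) r \<subseteq> C"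
    proof
      fix x assume x: "x \<in> cball (p (s + d)) r"
      define x' where "x' = x - d *\<^sub>R (y - z)"
      have "p (s + d) - x = p s - x'" unfolding p_def x'_def by (simp add: algebra_simps)
      then have "x' \<in> cball (p s) r" using x by (simp add: dist_norm)
      moreover have "x \<in> ball x' e" using de d by (simp add: x'_def dist_norm)
      ultimately show "x \<in> C" using e(2) interior_subset by blast
    qed
    then have "s + d \<in> A r" using A_iff d s01 by auto
    then show False using s(2) d(1) by fastforce
  qed
  then obtain q where q: "q \<in> cball (p s) r" "q \<notin> interior C" by blast
  define u where "u = q - p s"
  have u: "regular_normal C q u" "norm u = r"
    using regular_normal_at_touching_ball[OF C(1,2) r(1) ball q] by (auto simp: u_def)
  have uu: "u \<bullet> u = r * r" using u(2) by (simp add: dot_square_norm power2_eq_square)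
  have uq: "u \<bullet> q = u \<bullet> p s + r * r" using uu by (simp add: u_def inner_diff_right)
  \<comment> \<open>The point of the large ball farthest in direction \<open>u\<close> obeys the
    support inequality at \<open>q\<close>; this bounds the slope \<open>u \<bullet> (y - z)\<close>
    from below.\<close>
  have "z + (R / r) *\<^sub>R u \<in> cball z R" using R r u(2) by (simp add: dist_norm)
  then have "u \<bullet> (z + (R / r) *\<^sub>R u) \<le> u \<bullet> q"
    using R u(1) unfolding regular_normal_def by blast
  then have "u \<bullet> z + R * r \<le> u \<bullet> p s + r * r"
    using uq uu r(1) by (simp add: inner_add_right)
  then have 1: "(R - r) * r \<le> s * (u \<bullet> (y - z))"
    by (simp add: p_def inner_add_right algebra_simps)
  define a where "a = u \<bullet> (y - z)"
  have pos: "(R - r) * r > 0" by (rule mult_pos_pos) (use r in linarith)+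
  then have "s * a > 0" using 1 by (simp add: a_def)
  then have a: "a > 0" using s01 by (simp add: zero_less_mult_iff)
  have "s * a \<le> 1 * a" using s\<sigma> \<sigma>1 a by (intro mult_right_mono) auto
  then have 2: "(R - r) * r \<le> a" using 1 by (simp add: a_def)
  have "3 * r * r \<le> R * r" using r by (intro mult_right_mono) auto
  then have "(1 - \<sigma>) * (2 / 3 * R * r) \<le> (1 - \<sigma>) * ((R - r) * r)"
    using \<sigma>1 by (intro mult_left_mono) (auto simp: algebra_simps)
  moreover have "(1 - \<sigma>) * (2 / 3 * R * r) = 2 * r * r"
  proof -
    have "(1 - \<sigma>) * (2 / 3 * R * r) = ((1 - \<sigma>) * R) * (2 / 3 * r)" by simp
    also have "\<dots> = 2 * r * r" unfolding r(3)[symmetric] by simp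
    finally show ?thesis .
  qed
  moreover have "(1 - \<sigma>) * ((R - r) * r) \<le> (1 - \<sigma>) * a" using 2 \<sigma>1 by simp
  moreover have "(1 - \<sigma>) * a \<le> (1 - s) * a" using s\<sigma> a by (intro mult_right_mono) auto
  moreover have "r * r > 0" using r by simp
  ultimately have "r * r < (1 - s) * a" by linarith
  moreover have "u \<bullet> y - u \<bullet> q = (1 - s) * a - r * r"
    unfolding uq a_def p_def by (simp add: inner_add_right inner_diff_right algebra_simps)
  ultimately have "u \<bullet> q < u \<bullet> y" by linarith
  then show thesis using that u(1) by blast
qed

section \<open>Pushing contact points into the interior up to a planar shadow\<close>

text \<open>Let \<open>T\<close> be the set of points with the same shadow on
  \<open>span {a, b}\<close> as some \<open>x + \<delta> *\<^sub>R s\<close> with positive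
  \<open>\<delta>\<close>. If \<open>T\<close> missed the interior, a separating functional would
  lie in \<open>span {a, b}\<close> and support \<open>C\<close> at \<open>x\<close>, hence be a
  positive multiple of \<open>u\<close>. Separation makes it nonnegative on \<open>s\<close>,
  contradicting \<open>us\<close>.\<close>

lemma regular_normal_touch:
  fixes C :: "'a::euclidean_space set"
  assumes C: "closed C" "convex C" "interior C \<noteq> {}" and reg: "regular_normal C x u"
    and us: "u \<in> span {a, b} \<Longrightarrow> s \<bullet> u < 0"
  obtains \<delta> y where "\<delta> > 0" "y \<in> interior C" "(y - x - \<delta> *\<^sub>R s) \<bullet> a = 0" "(y - x - \<delta> *\<^sub>R s) \<bullet> b = 0"
proof -
  define T where "T = {p. \<exists>\<delta>>0. (p - x - \<delta> *\<^sub>R s) \<bullet> a = 0 \<and> (p - x - \<delta> *\<^sub>R s) \<bullet> b = 0}"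
  have T_I: "x + \<delta> *\<^sub>R s + w \<in> T" if "\<delta> > 0" "w \<bullet> a = 0" "w \<bullet> b = 0" for \<delta> w
    unfolding T_def using that by (intro CollectI exI[of _ \<delta>]) (auto simp: algebra_simps)
  have "convex T"
  proof (rule convexI)
    fix p q and k l :: real
    assume "p \<in> T" "q \<in> T" and kl: "0 \<le> k" "0 \<le> l" "k + l = 1"
    then obtain d e where d: "d > 0" "(p - x - d *\<^sub>R s) \<bullet> a = 0" "(p - x - d *\<^sub>R s) \<bullet> b = 0"
      and e: "e > 0" "(q - x - e *\<^sub>R s) \<bullet> a = 0" "(q - x - e *\<^sub>R s) \<bullet> b = 0"
      unfolding T_def by blast
    have k: "k = 1 - l" using kl by simp
    have eq: "(k *\<^sub>R p + l *\<^sub>R q) - x - (k * d + l * e) *\<^sub>R s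
        = k *\<^sub>R (p - x - d *\<^sub>R s) + l *\<^sub>R (q - x - e *\<^sub>R s)"
      unfolding k by (simp add: algebra_simps)
    have "k * d + l * e > 0"
      using kl d(1) e(1) by (smt (verit) mult_nonneg_nonneg mult_pos_pos)
    then show "k *\<^sub>R p + l *\<^sub>R q \<in> T"
      unfolding T_def using d e
      by (intro CollectI exI[of _ "k * d + l * e"]) (simp add: eq inner_add_left)
  qed
  moreover have "T \<noteq> {}" using T_I[of 1 0] by auto
  moreover have False if disj: "interior C \<inter> T = {}"
  proof -
    obtain v where v: "v \<noteq> 0" "\<And>y z. y \<in> C \<Longrightarrow> z \<in> T \<Longrightarrow> v \<bullet> y \<le> v \<bullet> z"
      using separate_from_interior[OF C \<open>convex T\<close> \<open>T \<noteq> {}\<close> disj] by blast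
    have x: "x \<in> C" using reg by (simp add: regular_normal_def)
    have lower: "v \<bullet> y \<le> v \<bullet> x + \<delta> * (v \<bullet> s) + v \<bullet> w"
      if "y \<in> C" "\<delta> > 0" "w \<bullet> a = 0" "w \<bullet> b = 0" for y \<delta> w
      using v(2)[OF that(1) T_I[OF that(2-)]] by (simp add: inner_add_right)
    define w where "w = v - orth_proj (span {a, b}) v"
    have w: "w \<bullet> a = 0" "w \<bullet> b = 0"
      unfolding w_def by (auto intro!: orth_proj_orthogonal span_base)
    have "w \<bullet> orth_proj (span {a, b}) v = 0"
      unfolding w_def by (intro orth_proj_orthogonal orth_proj_in subspace_span)
    then have "v \<bullet> w = w \<bullet> w"
      by (simp add: w_def inner_diff_left inner_diff_right inner_commute)
    moreover have "v \<bullet> w = 0"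
    proof (rule ccontr)
      assume nz: "v \<bullet> w \<noteq> 0"
      \<comment> \<open>With this multiple of \<open>w\<close> the separation would read
        \<open>v \<bullet> x \<le> v \<bullet> x - 1\<close>.\<close>
      define k where "k = (- (v \<bullet> s) - 1) / (v \<bullet> w)"
      have "v \<bullet> x \<le> v \<bullet> x + 1 * (v \<bullet> s) + v \<bullet> (k *\<^sub>R w)"
        by (rule lower) (use x w in auto)
      then show False using nz by (simp add: k_def)
    qed
    ultimately have "w = 0" by simp
    then have vspan: "v \<in> span {a, b}"
      using orth_proj_in[OF subspace_span, of "{a, b}" v] by (simp add: w_def)
    \<comment> \<open>The elements of \<open>T\<close> have positive \<open>\<delta>\<close>, so
      \<open>x\<close> is only reached in the limit; hence the argument with an arbitrary
      \<open>e\<close>.\<close>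
    have "v \<bullet> y \<le> v \<bullet> x" if y: "y \<in> C" for y
    proof (rule field_le_epsilon)
      fix e :: real assume e: "e > 0"
      define d where "d = e / (\<bar>v \<bullet> s\<bar> + 1)"
      have d: "d > 0" using e by (simp add: d_def add_nonneg_pos)
      have "d * (v \<bullet> s) \<le> d * (\<bar>v \<bullet> s\<bar> + 1)" using d by (intro mult_left_mono) auto
      also have "\<dots> = e" by (simp add: d_def)
      finally show "v \<bullet> y \<le> v \<bullet> x + e" using lower[OF y d, of 0] by simp
    qed
    then obtain c where c: "c \<ge> 0" "v = c *\<^sub>R u"
      using reg unfolding regular_normal_def by blast
    then have c0: "c > 0" using v(1) by auto
    then have "u = (1 / c) *\<^sub>R v" using c by simp
    then have "u \<in> span {a, b}" using vspan by (simp add: span_scale)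
    then have "s \<bullet> u < 0" by (rule us)
    moreover have "v \<bullet> s \<ge> 0" using lower[OF x, of 1 0] by simp
    ultimately show False using c c0 by (simp add: inner_commute mult_le_0_iff zero_le_mult_iff)
  qed
  ultimately obtain y where "y \<in> interior C" "y \<in> T" by blast
  then show thesis using that unfolding T_def by blast
qed

text \<open>Compactness of the set of orthonormal pairs turns solvability for each pair into one
  perturbation size for all. If each \<open>inverse (real (Suc k))\<close> failed for some pair, a
  limit pair would still have a solution with points in the open set \<open>U\<close>, and a small
  correction of these points would solve the perturbed problem for nearby pairs.\<close>

lemma orthonormal_pairs_uniform:
  fixes x d :: "'i \<Rightarrow> 'a::euclidean_space"
  assumes I: "finite I" and O: "open U"
    and ex: "\<And>a b :: 'a. norm a = 1 \<Longrightarrow> norm b = 1 \<Longrightarrow> a \<bullet> b = 0 \<Longrightarrow>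
      \<exists>s. \<forall>i\<in>I. \<exists>y\<in>U. (y - x i - s) \<bullet> a = 0 \<and> (y - x i - s) \<bullet> b = 0"
  obtains \<epsilon> where "\<epsilon> > 0" "\<And>a b :: 'a. norm a = 1 \<Longrightarrow> norm b = 1 \<Longrightarrow> a \<bullet> b = 0 \<Longrightarrow>
      \<exists>s. \<forall>i\<in>I. \<exists>y\<in>U. (y - (x i + \<epsilon> *\<^sub>R d i) - s) \<bullet> a = 0 \<and> (y - (x i + \<epsilon> *\<^sub>R d i) - s) \<bullet> b = 0"
proof (rule ccontr)
  assume no: "\<not> thesis"
  define S where "S = {p :: 'a \<times> 'a. norm (fst p) = 1 \<and> norm (snd p) = 1 \<and> fst p \<bullet> snd p = 0}"
  define good where "good \<epsilon> p \<longleftrightarrow> (\<exists>s. \<forall>i\<in>I. \<exists>y\<in>U. (y - (x i + \<epsilon> *\<^sub>R d i) - s) \<bullet> fst p = 0 \<and>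
      (y - (x i + \<epsilon> *\<^sub>R d i) - s) \<bullet> snd p = 0)" for \<epsilon> p
  have "S \<subseteq> cball 0 1 \<times> cball 0 1" by (auto simp: S_def)
  then have "bounded S" by (rule bounded_subset[OF bounded_Times[OF bounded_cball bounded_cball]])
  moreover have "closed S"
    unfolding S_def by (intro closed_Collect_conj closed_Collect_eq continuous_intros)
  ultimately have "compact S" by (simp add: compact_eq_bounded_closed)
  have "\<exists>p\<in>S. \<not> good (inverse (real (Suc k))) p" for k
  proof (rule ccontr)
    assume "\<not> ?thesis"
    then have "good (inverse (real (Suc k))) (a, b)"
      if "norm a = 1" "norm b = 1" "a \<bullet> b = 0" for a b
      using that unfolding S_def by simp
    then have thesis
      by (intro that[of "inverse (real (Suc k))"]) (simp_all add: good_def)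
    with no show False by blast
  qed
  then obtain P where P: "\<And>k. P k \<in> S" "\<And>k. \<not> good (inverse (real (Suc k))) (P k)" by metis
  obtain p r where p: "p \<in> S" "strict_mono r" "(P \<circ> r) \<longlonglongrightarrow> p"
    using \<open>compact S\<close> P(1) unfolding compact_def by metis
  define a b e where "a k = fst (P (r k))" and "b k = snd (P (r k))"
    and "e k = inverse (real (Suc (r k)))" for k
  have la: "a \<longlonglongrightarrow> fst p" and lb: "b \<longlonglongrightarrow> snd p"
    using tendsto_fst[OF p(3)] tendsto_snd[OF p(3)] unfolding a_def b_def comp_def by auto
  have le: "e \<longlonglongrightarrow> 0"
    using LIMSEQ_subseq_LIMSEQ[OF LIMSEQ_inverse_real_of_nat p(2)] unfolding e_def comp_def .
  have "\<exists>s. \<forall>i\<in>I. \<exists>y\<in>U. (y - x i - s) \<bullet> fst p = 0 \<and> (y - x i - s) \<bullet> snd p = 0"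
    using p(1) by (intro ex) (auto simp: S_def)
  then obtain s y where y: "\<And>i. i \<in> I \<Longrightarrow> y i \<in> U" "\<And>i. i \<in> I \<Longrightarrow> (y i - x i - s) \<bullet> fst p = 0"
      "\<And>i. i \<in> I \<Longrightarrow> (y i - x i - s) \<bullet> snd p = 0"
    by metis
  define z where "z i k = y i - (x i + e k *\<^sub>R d i) - s" for i k
  \<comment> \<open>Removing the components of the defect \<open>z i k\<close> along
    \<open>a k\<close> and \<open>b k\<close> makes the perturbed equations exact. The correction
    tends to 0, so the points eventually stay in \<open>U\<close>.\<close>
  define y' where "y' i k = y i - (z i k \<bullet> a k) *\<^sub>R a k - (z i k \<bullet> b k) *\<^sub>R b k" for i k
  have "\<forall>\<^sub>F k in sequentially. y' i k \<in> U" if i: "i \<in> I" for i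
  proof -
    have lz: "z i \<longlonglongrightarrow> y i - (x i + 0 *\<^sub>R d i) - s"
      unfolding z_def by (intro tendsto_intros le)
    have "y' i \<longlonglongrightarrow> y i - ((y i - (x i + 0 *\<^sub>R d i) - s) \<bullet> fst p) *\<^sub>R fst p
        - ((y i - (x i + 0 *\<^sub>R d i) - s) \<bullet> snd p) *\<^sub>R snd p"
      unfolding y'_def by (intro tendsto_intros la lb lz)
    then have "y' i \<longlonglongrightarrow> y i" using y(2,3)[OF i] by simp
    then show ?thesis using O y(1)[OF i] topological_tendstoD by blast
  qed
  then have "\<forall>\<^sub>F k in sequentially. \<forall>i\<in>I. y' i k \<in> U"
    using I by (simp add: eventually_ball_finite)
  then obtain k where k: "\<And>i. i \<in> I \<Longrightarrow> y' i k \<in> U"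
    unfolding eventually_sequentially by blast
  have ab: "norm (a k) = 1" "norm (b k) = 1" "a k \<bullet> b k = 0"
    using P(1)[of "r k"] by (auto simp: S_def a_def b_def)
  have "(y' i k - (x i + e k *\<^sub>R d i) - s) \<bullet> a k = 0 \<and> (y' i k - (x i + e k *\<^sub>R d i) - s) \<bullet> b k = 0" for i
  proof -
    have "y' i k - (x i + e k *\<^sub>R d i) - s = z i k - (z i k \<bullet> a k) *\<^sub>R a k - (z i k \<bullet> b k) *\<^sub>R b k"
      by (simp add: y'_def z_def)
    then show ?thesis using ab by (simp add: inner_diff_left dot_square_norm inner_commute[of "b k"])
  qed
  then have "good (e k) (P (r k))"
    unfolding good_def a_def[symmetric] b_def[symmetric] using k by blast
  then show False using P(2)[of "r k"] by (simp add: e_def)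
qed

section \<open>The normal space and the cylinder over a convex set\<close>

definition normal_space :: "'a::euclidean_space set \<Rightarrow> 'a set" where
  "normal_space L = {w. \<forall>x\<in>L. \<forall>y\<in>L. w \<bullet> (x - y) = 0}"

text \<open>Thickening \<open>L\<close> by the orthogonal complement of its direction space gives a set with
  nonempty interior whose normals are the normals of \<open>L\<close> relative to its affine hull.\<close>

definition cylinder :: "'a::euclidean_space set \<Rightarrow> 'a set" where
  "cylinder L = {x + w | x w. x \<in> L \<and> w \<in> normal_space L}"

lemma subspace_normal_space: "subspace (normal_space L)"
  unfolding normal_space_def subspace_def by (auto simp: inner_add_left)

lemma inner_normal_space:
  assumes "w \<in> normal_space L" "x \<in> L" "y \<in> L"
  shows "w \<bullet> x = w \<bullet> y"
proof -
  have "w \<bullet> (x - y) = 0" using assms unfolding normal_space_def by blast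
  then show ?thesis by (simp add: inner_diff_right)
qed

lemma cylinder_alt: "cylinder L = (\<Union>x\<in>L. \<Union>w\<in>normal_space L. {x + w})"
  unfolding cylinder_def by blast

lemma cylinder_add:
  assumes "x \<in> cylinder L" "w \<in> normal_space L"
  shows "x + w \<in> cylinder L"
proof -
  obtain l v where "x = l + v" "l \<in> L" "v \<in> normal_space L"
    using assms(1) unfolding cylinder_def by blast
  then have "x + w = l + (v + w)" "v + w \<in> normal_space L"
    using assms(2) subspace_add[OF subspace_normal_space] by auto
  with \<open>l \<in> L\<close> show ?thesis unfolding cylinder_def by blast
qed

lemma subset_cylinder: "L \<subseteq> cylinder L"
proof
  fix x assume "x \<in> L"
  then show "x \<in> cylinder L"
    unfolding cylinder_def using subspace_0[OF subspace_normal_space[of L]] by force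
qed

lemma closed_cylinder: "compact_convex L \<Longrightarrow> closed (cylinder L)"
  unfolding cylinder_alt compact_convex_def
  by (intro compact_closed_sums closed_subspace subspace_normal_space) simp

lemma convex_cylinder: "compact_convex L \<Longrightarrow> convex (cylinder L)"
  unfolding cylinder_alt compact_convex_def
  by (intro convex_sums subspace_imp_convex[OF subspace_normal_space]) simp

text \<open>A hyperplane containing the cylinder would have its normal in
  \<open>normal_space L\<close>, but the cylinder is invariant under shifts by that space.\<close>

lemma interior_cylinder_nonempty:
  assumes "compact_convex L"
  shows "interior (cylinder L) \<noteq> {}"
proof
  assume "interior (cylinder L) = {}"
  then obtain a b where a: "a \<noteq> 0" "cylinder L \<subseteq> {x. a \<bullet> x = b}"
    using empty_interior_subset_hyperplane[OF convex_cylinder[OF assms]] by blast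
  obtain x where x: "x \<in> L" using assms unfolding compact_convex_def by blast
  have "a \<in> normal_space L"
    unfolding normal_space_def using a(2) subset_cylinder[of L] by (auto simp: inner_diff_right)
  then have "a \<bullet> (x + a) = b" "a \<bullet> x = b"
    using a(2) cylinder_add[of x L a] subset_cylinder[of L] x by auto
  then show False using a(1) by (simp add: inner_add_right)
qed

lemma mem_of_mem_cylinder:
  assumes "y \<in> cylinder L" "x \<in> L" "\<And>w. w \<in> normal_space L \<Longrightarrow> w \<bullet> y = w \<bullet> x"
  shows "y \<in> L"
proof -
  obtain l v where y: "y = l + v" "l \<in> L" "v \<in> normal_space L"
    using assms(1) unfolding cylinder_def by blast
  then have "v \<bullet> v = 0"
    using assms(3)[OF y(3)] inner_normal_space[OF y(3,2) assms(2)] by (simp add: inner_add_right)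
  then show ?thesis using y by simp
qed

text \<open>The cylinder contains both \<open>x + w\<close> and \<open>x - w\<close>, so a
  functional maximal at \<open>x\<close> cannot change along \<open>w\<close>.\<close>

lemma support_cylinder_orthogonal:
  assumes "x \<in> cylinder L" "\<And>y. y \<in> cylinder L \<Longrightarrow> v \<bullet> y \<le> v \<bullet> x" "w \<in> normal_space L"
  shows "v \<bullet> w = 0"
proof -
  have "v \<bullet> (x + w) \<le> v \<bullet> x" "v \<bullet> (x + - w) \<le> v \<bullet> x"
    using assms cylinder_add subspace_neg[OF subspace_normal_space] by blast+
  then have "v \<bullet> w \<le> 0" "- (v \<bullet> w) \<le> 0" unfolding inner_add_right inner_minus_right by linarith+
  then show ?thesis by simp
qed

text \<open>Supporting functionals ignore the normal space, so a contact point can be slid along it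
  into \<open>L\<close>. The simplex built later needs its contact points in \<open>L\<close>
  itself.\<close>

lemma regular_normal_cylinder_base:
  assumes "regular_normal (cylinder L) x u"
  obtains l where "l \<in> L" "regular_normal (cylinder L) l u"
proof -
  have x: "x \<in> cylinder L" using assms by (simp add: regular_normal_def)
  then obtain l w where lw: "x = l + w" "l \<in> L" "w \<in> normal_space L"
    unfolding cylinder_def by blast
  have l: "l \<in> cylinder L" using lw(2) subset_cylinder by blast
  have "(\<forall>y\<in>cylinder L. v \<bullet> y \<le> v \<bullet> x) \<longleftrightarrow> (\<forall>y\<in>cylinder L. v \<bullet> y \<le> v \<bullet> l)" for v
    using support_cylinder_orthogonal[OF x _ lw(3), of v] support_cylinder_orthogonal[OF l _ lw(3), of v]
    unfolding lw(1) by (auto simp: inner_add_right)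
  then have "regular_normal (cylinder L) l u"
    using assms l unfolding regular_normal_def by simp
  with lw(2) show thesis by (rule that)
qed

text \<open>The point reflection sending \<open>x\<close> to \<open>t - x\<close> preserves
  \<open>C\<close> and negates normal cones. This makes the signs of regular normals
  immaterial.\<close>

lemma regular_normal_uminus:
  assumes sym: "\<And>x. x \<in> C \<Longrightarrow> t - x \<in> C" and reg: "regular_normal C x u"
  shows "regular_normal C (t - x) (- u)"
proof -
  have flip: "(\<forall>y\<in>C. v \<bullet> y \<le> v \<bullet> (t - x)) \<longleftrightarrow> (\<forall>y\<in>C. (- v) \<bullet> y \<le> (- v) \<bullet> x)" for v
  proof -
    have "(\<forall>y\<in>C. v \<bullet> y \<le> v \<bullet> (t - x)) \<longleftrightarrow> (\<forall>y\<in>C. v \<bullet> (t - y) \<le> v \<bullet> (t - x))"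
      using sym by (metis diff_diff_eq2 add_diff_cancel_left')
    then show ?thesis by (simp add: inner_diff_right)
  qed
  have "\<exists>c\<ge>0. v = c *\<^sub>R (- u)" if supp: "\<forall>y\<in>C. v \<bullet> y \<le> v \<bullet> (t - x)" for v
  proof -
    have "\<forall>y\<in>C. (- v) \<bullet> y \<le> (- v) \<bullet> x" using supp flip[of v] by blast
    then obtain c where "c \<ge> 0" "- v = c *\<^sub>R u"
      using reg unfolding regular_normal_def by blast
    then show ?thesis by (metis minus_equation_iff scaleR_minus_right)
  qed
  moreover have "\<forall>y\<in>C. (- u) \<bullet> y \<le> (- u) \<bullet> (t - x)"
    unfolding flip using reg by (simp add: regular_normal_def)
  ultimately show ?thesis
    using reg sym unfolding regular_normal_def by simp
qed

section \<open>Circuits of regular normals\<close>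

text \<open>Each contact point can be pushed into the interior along \<open>s\<close> by its own
  amount; the minimum of these finitely many amounts serves all of them.\<close>

lemma regular_simplex_uniform_shift:
  fixes C :: "'a::euclidean_space set"
  assumes C: "closed C" "convex C" "interior C \<noteq> {}" and I: "finite I"
    and reg: "\<And>i. i \<in> I \<Longrightarrow> regular_normal C (x i) (u i)"
    and s: "\<And>i. i \<in> I \<Longrightarrow> u i \<in> span {a, b} \<Longrightarrow> s \<bullet> u i < 0"
  shows "\<exists>s. \<forall>i\<in>I. \<exists>y\<in>interior C. (y - x i - s) \<bullet> a = 0 \<and> (y - x i - s) \<bullet> b = 0"
proof (cases "I = {}")
  case False
  have "\<exists>\<delta> y. \<delta> > 0 \<and> y \<in> interior C \<and> (y - x i - \<delta> *\<^sub>R s) \<bullet> a = 0 \<and> (y - x i - \<delta> *\<^sub>R s) \<bullet> b = 0"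
    if i: "i \<in> I" for i
    using regular_normal_touch[OF C reg[OF i] s[OF i]] by metis
  then obtain \<delta> y where \<delta>: "\<And>i. i \<in> I \<Longrightarrow> \<delta> i > (0::real)" and y: "\<And>i. i \<in> I \<Longrightarrow> y i \<in> interior C"
    "\<And>i. i \<in> I \<Longrightarrow> (y i - x i - \<delta> i *\<^sub>R s) \<bullet> a = 0" "\<And>i. i \<in> I \<Longrightarrow> (y i - x i - \<delta> i *\<^sub>R s) \<bullet> b = 0"
    by metis
  define \<delta>' where "\<delta>' = Min (\<delta> ` I)"
  have \<delta>': "\<delta>' > 0" "\<And>i. i \<in> I \<Longrightarrow> \<delta>' \<le> \<delta> i"
    using I False \<delta> by (auto simp: \<delta>'_def)
  have "\<exists>y\<in>interior C. (y - x i - \<delta>' *\<^sub>R s) \<bullet> a = 0 \<and> (y - x i - \<delta>' *\<^sub>R s) \<bullet> b = 0" if i: "i \<in> I" for i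
  proof -
    \<comment> \<open>Moving only the fraction \<open>k\<close> of the way from \<open>x i\<close>
      to \<open>y i\<close> scales the shift down to the common \<open>\<delta>'\<close>, and the
      point reached is still interior by convexity.\<close>
    define k where "k = \<delta>' / \<delta> i"
    have k: "0 < k" "k \<le> 1" "k * \<delta> i = \<delta>'" using \<delta>' \<delta>[OF i] i by (auto simp: k_def)
    have "x i \<in> C" using reg[OF i] by (simp add: regular_normal_def)
    then have "x i - k *\<^sub>R (x i - y i) \<in> interior C"
      using C(2) y(1)[OF i] k mem_interior_closure_convex_shrink[of C "y i" "x i" k] closure_subset by blast
    moreover have "x i - k *\<^sub>R (x i - y i) - x i - \<delta>' *\<^sub>R s = k *\<^sub>R (y i - x i - \<delta> i *\<^sub>R s)"
      unfolding k(3)[symmetric] by (simp add: algebra_simps)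
    ultimately show ?thesis using y(2,3)[OF i] by (metis inner_scaleR_left mult_zero_right)
  qed
  then show ?thesis by blast
qed auto

text \<open>The simplex spanned by the contact points, slightly enlarged, still casts
  shadows that fit into those of \<open>L\<close>, because no plane contains all the normals.\<close>

lemma positive_circuit_not_two_reliable:
  fixes L :: "'a::euclidean_space set"
  assumes L: "compact_convex L" and dim: "DIM('a) \<ge> 2" and I: "finite I" "I \<noteq> {}"
    and x: "\<And>i. i \<in> I \<Longrightarrow> x i \<in> L"
    and reg: "\<And>i. i \<in> I \<Longrightarrow> regular_normal (cylinder L) (x i) (u i)"
    and c: "\<And>i. i \<in> I \<Longrightarrow> c i > (0::real)" and c0: "(\<Sum>i\<in>I. c i *\<^sub>R u i) = 0"
    and sep: "\<And>a b. \<exists>s. \<forall>i\<in>I. u i \<in> span {a, b} \<longrightarrow> s \<bullet> u i < 0"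
  shows "\<not> two_reliable L"
proof
  assume rel: "two_reliable L"
  define C where "C = cylinder L"
  define W where "W = normal_space L"
  have C: "closed C" "convex C" "interior C \<noteq> {}"
    unfolding C_def using L closed_cylinder convex_cylinder interior_cylinder_nonempty by auto
  have W: "subspace W" unfolding W_def by (rule subspace_normal_space)
  have regC: "\<And>i. i \<in> I \<Longrightarrow> regular_normal C (x i) (u i)" using reg by (simp add: C_def)
  obtain x0 where x0: "x0 \<in> L" using L unfolding compact_convex_def by blast
  have "\<exists>s. \<forall>i\<in>I. \<exists>y\<in>interior C. (y - x i - s) \<bullet> a = 0 \<and> (y - x i - s) \<bullet> b = 0" for a b
  proof -
    obtain s where "\<forall>i\<in>I. u i \<in> span {a, b} \<longrightarrow> s \<bullet> u i < 0" using sep by blast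
    then show ?thesis
      by (intro regular_simplex_uniform_shift[OF C I(1) regC]) auto
  qed
  then obtain \<epsilon> where \<epsilon>: "\<epsilon> > 0" "\<And>a b :: 'a. norm a = 1 \<Longrightarrow> norm b = 1 \<Longrightarrow> a \<bullet> b = 0 \<Longrightarrow>
      \<exists>s. \<forall>i\<in>I. \<exists>y\<in>interior C. (y - (x i + \<epsilon> *\<^sub>R (x i - x0)) - s) \<bullet> a = 0 \<and>
        (y - (x i + \<epsilon> *\<^sub>R (x i - x0)) - s) \<bullet> b = 0"
    using orthonormal_pairs_uniform[OF I(1) open_interior, where x = x and d = "\<lambda>i. x i - x0"] by metis
  \<comment> \<open>The vertices of the simplex dilated from \<open>x0\<close> by the factor
    \<open>1 + \<epsilon>\<close>.\<close>
  define k where "k i = x i + \<epsilon> *\<^sub>R (x i - x0)" for i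
  define K where "K = convex hull (k ` I)"
  have "compact_convex K"
    unfolding compact_convex_def K_def using I
    by (auto intro: finite_imp_compact_convex_hull)
  moreover have "contains_translate (orth_proj \<xi> ` L) (orth_proj \<xi> ` K)"
    if \<xi>: "subspace \<xi>" "dim \<xi> = 2" for \<xi>
  proof -
    obtain B where B: "independent B" "card B = 2" "span B = \<xi>"
      using orthonormal_basis_subspace[OF \<xi>(1)] \<xi>(2) by metis
    have "finite B" using B(2) card.infinite by fastforce
    \<comment> \<open>The cylinder controls \<open>L\<close> only modulo \<open>W\<close>, so the
      test plane is built from the components of \<open>B\<close> orthogonal to \<open>W\<close>;
      directions in \<open>W\<close> are treated separately.\<close>
    define q where "q p = p - orth_proj W p" for p
    have qW: "q p \<bullet> w = 0" if "w \<in> W" for p w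
      unfolding q_def by (rule orth_proj_orthogonal[OF W that])
    have "dim (q ` B) \<le> 2"
      using dim_le_card'[of "q ` B"] card_image_le[of B q] \<open>finite B\<close> B(2) by simp
    then obtain a b where ab: "norm a = 1" "norm b = 1" "a \<bullet> b = 0" "q ` B \<subseteq> span {a, b}"
      using orthonormal_pair_span_superset[OF _ dim] by metis
    obtain s where s: "\<And>i. i \<in> I \<Longrightarrow> \<exists>y\<in>interior C. (y - k i - s) \<bullet> a = 0 \<and> (y - k i - s) \<bullet> b = 0"
      using \<epsilon>(2)[OF ab(1-3)] unfolding k_def by blast
    have vertex: "\<exists>y\<in>L. \<forall>w\<in>\<xi>. (y - k i - q s) \<bullet> w = 0" if i: "i \<in> I" for i
    proof -
      obtain y where y: "y \<in> C" "(y - k i - s) \<bullet> a = 0" "(y - k i - s) \<bullet> b = 0"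
        using s[OF i] interior_subset by blast
      obtain l w where l: "y = l + w" "l \<in> L" "w \<in> W"
        using y(1) unfolding C_def W_def cylinder_def by blast
      define z where "z = l - k i - q s"
      \<comment> \<open>A vector of \<open>W\<close> has the same inner product with all points of
        \<open>L\<close>, hence also with \<open>k i\<close>, and \<open>q s\<close> is orthogonal
        to \<open>W\<close>.\<close>
      have zW: "z \<bullet> v = 0" if v: "v \<in> W" for v
      proof -
        have "v \<bullet> l = v \<bullet> x0" "v \<bullet> x i = v \<bullet> x0"
          by (rule inner_normal_space[OF v[unfolded W_def]]; use l(2) x[OF i] x0 in simp)+
        then have "v \<bullet> z = 0"
          using qW[OF v, of s] unfolding z_def k_def
          by (simp add: inner_diff_right inner_add_right inner_commute)
        then show ?thesis by (simp add: inner_commute)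
      qed
      have "orthogonal (y - k i - s) v" if "v \<in> span {a, b}" for v
        by (rule orthogonal_to_span[OF that]) (use y in \<open>auto simp: orthogonal_def\<close>)
      then have zab: "(y - k i - s) \<bullet> v = 0" if "v \<in> span {a, b}" for v
        using that by (simp add: orthogonal_def)
      have "orthogonal z p" if p: "p \<in> B" for p
      proof -
        have "y - k i - s = z + (w - orth_proj W s)"
          unfolding z_def q_def l(1) by (simp add: algebra_simps)
        moreover have "(w - orth_proj W s) \<bullet> q p = 0"
          using qW[of "w - orth_proj W s" p] l(3) orth_proj_in[OF W] subspace_diff[OF W]
          by (simp add: inner_commute)
        moreover have "(y - k i - s) \<bullet> q p = 0" using zab ab(4) p by blast
        ultimately have "z \<bullet> q p = 0" by (simp add: inner_add_left)
        then show ?thesis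
          using zW[OF orth_proj_in[OF W], of p] unfolding q_def orthogonal_def
          by (simp add: inner_diff_right)
      qed
      then have "orthogonal z v" if "v \<in> \<xi>" for v
        using that orthogonal_to_span[of v B z] unfolding B(3) by blast
      then show ?thesis using l(2) unfolding z_def orthogonal_def by blast
    qed
    \<comment> \<open>By convexity it is enough that the vertices of \<open>K\<close> fit.\<close>
    have "convex {p. \<exists>y\<in>L. \<forall>w\<in>\<xi>. (y - p - q s) \<bullet> w = 0}"
    proof (rule convexI, clarsimp)
      fix p p' y y' and \<alpha> \<beta> :: real
      assume yy: "y \<in> L" "y' \<in> L" and ab: "0 \<le> \<alpha>" "0 \<le> \<beta>" "\<alpha> + \<beta> = 1"
        and o: "\<forall>w\<in>\<xi>. (y - p - q s) \<bullet> w = 0" "\<forall>w\<in>\<xi>. (y' - p' - q s) \<bullet> w = 0"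
      have "\<alpha> *\<^sub>R y + \<beta> *\<^sub>R y' \<in> L"
        using L yy ab unfolding compact_convex_def by (meson convexD)
      moreover have "(\<alpha> *\<^sub>R y + \<beta> *\<^sub>R y') - (\<alpha> *\<^sub>R p + \<beta> *\<^sub>R p') - q s
          = \<alpha> *\<^sub>R (y - p - q s) + \<beta> *\<^sub>R (y' - p' - q s)"
      proof -
        have "q s = (\<alpha> + \<beta>) *\<^sub>R q s" using ab by simp
        then show ?thesis by (simp add: algebra_simps)
      qed
      ultimately show "\<exists>y\<in>L. \<forall>w\<in>\<xi>. (y - (\<alpha> *\<^sub>R p + \<beta> *\<^sub>R p') - q s) \<bullet> w = 0"
        using o by (intro bexI[of _ "\<alpha> *\<^sub>R y + \<beta> *\<^sub>R y'"]) (simp_all add: inner_add_left)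
    qed
    then have "K \<subseteq> {p. \<exists>y\<in>L. \<forall>w\<in>\<xi>. (y - p - q s) \<bullet> w = 0}"
      unfolding K_def using vertex by (intro hull_minimal) auto
    then show ?thesis
      unfolding contains_translate_orth_proj_iff[OF \<xi>(1)] by blast
  qed
  ultimately have "contains_translate L K"
    using rel unfolding two_reliable_def by blast
  then obtain t where t: "\<And>p. p \<in> K \<Longrightarrow> t + p \<in> L"
    unfolding contains_translate_def by blast
  have "c i * (u i \<bullet> t) + \<epsilon> * (c i * (u i \<bullet> (x i - x0))) \<le> 0" if i: "i \<in> I" for i
  proof -
    have "t + k i \<in> L" using t i unfolding K_def by (simp add: hull_inc)
    then have "u i \<bullet> (t + k i) \<le> u i \<bullet> x i"
      using reg[OF i] subset_cylinder[of L] unfolding regular_normal_def by blast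
    then have "u i \<bullet> t + \<epsilon> * (u i \<bullet> (x i - x0)) \<le> 0"
      unfolding k_def by (simp add: inner_add_right)
    then have "c i * (u i \<bullet> t + \<epsilon> * (u i \<bullet> (x i - x0))) \<le> 0"
      using c[OF i] by (simp add: mult_le_0_iff)
    then show ?thesis by (simp add: algebra_simps)
  qed
  \<comment> \<open>Summing with the weights \<open>c i\<close> cancels the translation
    \<open>t\<close> and the centre \<open>x0\<close> by \<open>c0\<close>. What remains is at most
    0, whereas comparison with an interior point makes it positive.\<close>
  then have "(\<Sum>i\<in>I. c i * (u i \<bullet> t) + \<epsilon> * (c i * (u i \<bullet> (x i - x0)))) \<le> 0"
    by (rule sum_nonpos)
  moreover have cu: "(\<Sum>i\<in>I. c i * (u i \<bullet> v)) = 0" for v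
    using arg_cong[OF c0, of "\<lambda>w. w \<bullet> v"] by (simp add: inner_sum_left)
  ultimately have "\<epsilon> * (\<Sum>i\<in>I. c i * (u i \<bullet> (x i - x0))) \<le> 0"
    by (simp add: sum.distrib sum_distrib_left)
  then have le: "(\<Sum>i\<in>I. c i * (u i \<bullet> x i)) \<le> 0"
    using \<epsilon>(1) cu[of x0] by (simp add: mult_le_0_iff inner_diff_right right_diff_distrib sum_subtractf)
  obtain p where p: "p \<in> interior C" using C(3) by blast
  have "(\<Sum>i\<in>I. c i * (u i \<bullet> p)) < (\<Sum>i\<in>I. c i * (u i \<bullet> x i))"
  proof (rule sum_strict_mono[OF I])
    fix i assume i: "i \<in> I"
    have "u i \<bullet> p < u i \<bullet> x i"
      using interior_support_strict[OF p, of "u i"] regC[OF i] unfolding regular_normal_def by blast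
    then show "c i * (u i \<bullet> p) < c i * (u i \<bullet> x i)" using c[OF i] by simp
  qed
  then show False using le cu[of p] by simp
qed

text \<open>Prescribed values on \<open>B\<close> extend to a linear functional, and
  \<open>adjoint g 1\<close> is the vector representing it.\<close>

lemma independent_inner_extend:
  fixes B :: "'a::euclidean_space set" and f :: "'a \<Rightarrow> real"
  assumes "independent B"
  obtains s where "\<And>b. b \<in> B \<Longrightarrow> s \<bullet> b = f b"
proof -
  obtain g where g: "linear g" "\<forall>b\<in>B. g b = f b"
    using linear_independent_extend[OF assms] by blast
  have "adjoint g 1 \<bullet> b = f b" if "b \<in> B" for b
    using adjoint_works[OF g(1), of b 1] g(2) that by (simp add: inner_commute)
  then show thesis by (rule that)
qed

text \<open>All coefficients are nonzero, so \<open>insert w T\<close> is a circuit, and central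
  symmetry allows flipping normals until its coefficients are positive. If \<open>T\<close> had
  three elements, every plane would miss some \<open>j\<close> in \<open>T\<close>; the other
  normals of the circuit are independent, so one vector is negative on all of them.\<close>

lemma two_reliable_circuit_bound:
  fixes L :: "'a::euclidean_space set"
  assumes L: "compact_convex L" "centrally_symmetric L" "two_reliable L" and dim: "DIM('a) \<ge> 2"
    and T: "independent T" and w: "w = (\<Sum>t\<in>T. k t *\<^sub>R t)" and k: "\<And>t. t \<in> T \<Longrightarrow> k t \<noteq> 0"
    and reg: "\<And>v. v \<in> insert w T \<Longrightarrow> \<exists>x. regular_normal (cylinder L) x v"
  shows "card T \<le> 2"
proof (rule ccontr)
  assume "\<not> card T \<le> 2"
  then have cardT: "card T \<ge> 3" by simp
  have fin: "finite T" using T independent_bound by blast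
  have w_notin: "w \<notin> span (T - {j})" if j: "j \<in> T" for j
  proof
    assume a: "w \<in> span (T - {j})"
    have "w = k j *\<^sub>R j + (\<Sum>t\<in>T - {j}. k t *\<^sub>R t)"
      unfolding w by (rule sum.remove[OF fin j])
    then have "k j *\<^sub>R j = w - (\<Sum>t\<in>T - {j}. k t *\<^sub>R t)" by simp
    also have "\<dots> \<in> span (T - {j})"
      by (intro span_diff a span_sum span_scale span_base)
    finally have "(1 / k j) *\<^sub>R (k j *\<^sub>R j) \<in> span (T - {j})" by (rule span_scale)
    then have "j \<in> span (T - {j})" using k[OF j] by simp
    then show False using T j unfolding dependent_def by blast
  qed
  have wT: "w \<notin> T"
  proof
    assume "w \<in> T"
    have "\<not> T \<subseteq> {w}" using cardT card_mono[of "{w}" T] by auto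
    then obtain j where "j \<in> T" "j \<noteq> w" by blast
    then show False using w_notin[of j] \<open>w \<in> T\<close> by (simp add: span_base)
  qed
  define I where "I = insert w T"
  \<comment> \<open>The coefficients of the dependency obtained by moving \<open>w\<close> to the
    other side; their signs are absorbed into \<open>u\<close>.\<close>
  define \<kappa> where "\<kappa> v = (if v = w then - 1 else k v)" for v
  define u where "u v = sgn (\<kappa> v) *\<^sub>R v" for v
  have \<kappa>: "\<kappa> v \<noteq> 0" if "v \<in> I" for v
    using that k by (auto simp: I_def \<kappa>_def)
  obtain t where t: "uminus ` L = (+) t ` L"
    using L(2) unfolding centrally_symmetric_def by blast
  have sym: "- t - y \<in> cylinder L" if y: "y \<in> cylinder L" for y
  proof -
    obtain l v where l: "y = l + v" "l \<in> L" "v \<in> normal_space L"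
      using y unfolding cylinder_def by blast
    have "- l \<in> (+) t ` L" using l(2) t by blast
    then obtain l' where l': "l' \<in> L" "- l = t + l'" by blast
    have "- t - y = l' + - v"
      unfolding l(1) using l'(2) by (simp add: algebra_simps)
    moreover have "- v \<in> normal_space L" using l(3) subspace_neg[OF subspace_normal_space] by blast
    ultimately show ?thesis using l'(1) unfolding cylinder_def by blast
  qed
  have "\<exists>x\<in>L. regular_normal (cylinder L) x (u v)" if v: "v \<in> I" for v
  proof -
    obtain x where x: "regular_normal (cylinder L) x v" using reg v unfolding I_def by blast
    have "u v = v \<or> u v = - v" using \<kappa>[OF v] by (auto simp: u_def sgn_if)
    then obtain x' where "regular_normal (cylinder L) x' (u v)"
      using x regular_normal_uminus[OF sym x] by metis
    then show ?thesis using regular_normal_cylinder_base by blast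
  qed
  then obtain x where x: "\<And>v. v \<in> I \<Longrightarrow> x v \<in> L"
      "\<And>v. v \<in> I \<Longrightarrow> regular_normal (cylinder L) (x v) (u v)"
    by metis
  have "\<not> two_reliable L"
  proof (rule positive_circuit_not_two_reliable[OF L(1) dim _ _ x, where c = "\<lambda>v. \<bar>\<kappa> v\<bar>"])
    show "finite I" "I \<noteq> {}" using fin by (auto simp: I_def)
    show "\<bar>\<kappa> v\<bar> > 0" if "v \<in> I" for v using \<kappa>[OF that] by simp
    have "(\<Sum>v\<in>I. \<bar>\<kappa> v\<bar> *\<^sub>R u v) = (\<Sum>v\<in>I. \<kappa> v *\<^sub>R v)"
      by (simp add: u_def abs_mult_sgn)
    also have "\<dots> = - w + (\<Sum>v\<in>T. \<kappa> v *\<^sub>R v)"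
      unfolding I_def using fin wT by (simp add: \<kappa>_def)
    also have "(\<Sum>v\<in>T. \<kappa> v *\<^sub>R v) = w"
      unfolding w by (rule sum.cong) (use wT w in \<open>auto simp: \<kappa>_def\<close>)
    finally show "(\<Sum>v\<in>I. \<bar>\<kappa> v\<bar> *\<^sub>R u v) = 0" by simp
    show "\<exists>s. \<forall>i\<in>I. u i \<in> span {a, b} \<longrightarrow> s \<bullet> u i < 0" for a b
    proof -
      have "\<not> T \<subseteq> span {a, b}"
      proof
        assume "T \<subseteq> span {a, b}"
        then have "card T \<le> card {a, b}" using independent_span_bound[of "{a, b}" T] T by simp
        also have "\<dots> \<le> 2" by (simp add: card_insert_if)
        finally show False using cardT by simp
      qed
      then obtain j where j: "j \<in> T" "j \<notin> span {a, b}" by blast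
      \<comment> \<open>Exchanging \<open>j\<close> for \<open>w\<close> keeps independence, so
        \<open>s \<bullet> v = - \<kappa> v\<close> can be prescribed; then
        \<open>s \<bullet> u v\<close> is \<open>- \<bar>\<kappa> v\<bar>\<close>.\<close>
      have "independent (insert w (T - {j}))"
        by (intro independent_insertI w_notin[OF j(1)] independent_mono[OF T]) auto
      then obtain s where s: "\<And>v. v \<in> insert w (T - {j}) \<Longrightarrow> s \<bullet> v = - \<kappa> v"
        using independent_inner_extend[where f = "\<lambda>v. - \<kappa> v"] by metis
      have "s \<bullet> u v < 0" if v: "v \<in> I" "u v \<in> span {a, b}" for v
      proof -
        have "v \<in> span {a, b}"
        proof -
          have "sgn (\<kappa> v) *\<^sub>R u v = v" using \<kappa>[OF v(1)] by (simp add: u_def sgn_if)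
          then show ?thesis using span_scale[OF v(2)] by metis
        qed
        then have "v \<in> insert w (T - {j})" using v(1) j(2) by (auto simp: I_def)
        then have "s \<bullet> u v = - \<bar>\<kappa> v\<bar>" using s by (simp add: u_def abs_sgn mult.commute)
        then show ?thesis using \<kappa>[OF v(1)] by simp
      qed
      then show ?thesis by blast
    qed
  qed
  then show False using L(3) by blast
qed

section \<open>Grouping a basis of normals into singletons and pairs\<close>

text \<open>Applied to the basis expansion of \<open>u\<close>, the circuit bound leaves at most two
  basis vectors in its support \<open>S u\<close>. The two-element supports are the edges of a graph
  on \<open>B\<close>, and by an exchange argument this graph is a matching; its edges and the
  unmatched vertices form the partition.\<close>

lemma small_circuits_partition:
  fixes B U :: "'a::euclidean_space set"
  assumes B: "independent B" "B \<subseteq> U" "U \<subseteq> span B" and U0: "0 \<notin> U"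
    and circ: "\<And>T w k. T \<subseteq> U \<Longrightarrow> w \<in> U \<Longrightarrow> independent T \<Longrightarrow> w = (\<Sum>t\<in>T. k t *\<^sub>R t) \<Longrightarrow>
      (\<And>t. t \<in> T \<Longrightarrow> k t \<noteq> 0) \<Longrightarrow> card T \<le> 2"
  obtains \<P> where "\<Union>\<P> = B" "disjoint \<P>" "\<And>P. P \<in> \<P> \<Longrightarrow> card P \<le> 2"
    "\<And>u. u \<in> U \<Longrightarrow> \<exists>P\<in>\<P>. u \<in> span P"
proof -
  have fin: "finite B" using B(1) independent_bound by blast
  define r where "r = representation B"
  define S where "S u = {b. r u b \<noteq> 0}" for u
  have SB: "S u \<subseteq> B" for u
    unfolding S_def r_def using representation_ne_zero by blast
  have rep: "(\<Sum>b\<in>S u. r u b *\<^sub>R b) = u" if "u \<in> U" for u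
    unfolding S_def r_def using sum_nonzero_representation_eq[OF B(1)] B(3) that by blast
  have Sne: "S u \<noteq> {}" if "u \<in> U" for u
    using rep[OF that] U0 that by auto
  have Scard: "card (S u) \<le> 2" if u: "u \<in> U" for u
  proof (rule circ[OF _ u _ rep[OF u, symmetric]])
    show "S u \<subseteq> U" using SB B(2) by blast
    show "independent (S u)" using SB B(1) independent_mono by blast
  qed (auto simp: S_def)
  have finS: "finite (S u)" for u using SB fin finite_subset by blast
  define link where "link b b' \<longleftrightarrow> b \<noteq> b' \<and> (\<exists>u\<in>U. S u = {b, b'})" for b b'
  have link_sym: "link b b' \<Longrightarrow> link b' b" for b b'
    unfolding link_def by (auto simp: insert_commute)
  have link_B: "link b b' \<Longrightarrow> b \<in> B \<and> b' \<in> B" for b b'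
    unfolding link_def using SB by blast
  \<comment> \<open>If \<open>b\<close> had two neighbours, replacing \<open>b\<close> by
    \<open>u\<close> would express \<open>w\<close> through the three independent vectors
    \<open>u\<close>, \<open>b'\<close>, \<open>b''\<close> with nonzero coefficients.\<close>
  have link_unique: "b' = b''" if links: "link b b'" "link b b''" for b b' b''
  proof (rule ccontr)
    assume ne: "b' \<noteq> b''"
    obtain u w where u: "u \<in> U" "S u = {b, b'}" "b \<noteq> b'" and w: "w \<in> U" "S w = {b, b''}" "b \<noteq> b''"
      using links unfolding link_def by blast
    have bB: "b \<in> B" "b' \<in> B" "b'' \<in> B" using links link_B by blast+
    define \<alpha> \<beta> \<gamma> \<delta> where "\<alpha> = r u b" and "\<beta> = r u b'" and "\<gamma> = r w b" and "\<delta> = r w b''"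
    have nz: "\<alpha> \<noteq> 0" "\<beta> \<noteq> 0" "\<gamma> \<noteq> 0" "\<delta> \<noteq> 0"
      using u(2) w(2) unfolding S_def \<alpha>_def \<beta>_def \<gamma>_def \<delta>_def by blast+
    have ueq: "u = \<alpha> *\<^sub>R b + \<beta> *\<^sub>R b'" using rep[OF u(1)] u by (simp add: \<alpha>_def \<beta>_def)
    have weq: "w = \<gamma> *\<^sub>R b + \<delta> *\<^sub>R b''" using rep[OF w(1)] w by (simp add: \<gamma>_def \<delta>_def)
    have b_notin: "b \<notin> span {b', b''}"
    proof
      assume "b \<in> span {b', b''}"
      moreover have "{b', b''} \<subseteq> B - {b}" using bB u w by blast
      ultimately have "b \<in> span (B - {b})" using span_mono by blast
      then show False using B(1) bB unfolding dependent_def by blast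
    qed
    have u_notin: "u \<notin> span {b', b''}"
    proof
      assume "u \<in> span {b', b''}"
      then have "u - \<beta> *\<^sub>R b' \<in> span {b', b''}" by (intro span_diff span_scale) (auto simp: span_base)
      then have "\<alpha> *\<^sub>R b \<in> span {b', b''}" unfolding ueq by simp
      then have "(1 / \<alpha>) *\<^sub>R (\<alpha> *\<^sub>R b) \<in> span {b', b''}" by (rule span_scale)
      then show False using b_notin nz by simp
    qed
    have ind: "independent {u, b', b''}"
    proof (rule independent_insertI[OF u_notin])
      show "independent {b', b''}" by (rule independent_mono[OF B(1)]) (use bB in auto)
    qed
    have dist: "u \<noteq> b'" "u \<noteq> b''" using u_notin by (auto simp: span_base)
    \<comment> \<open>Solve \<open>ueq\<close> for \<open>b\<close> and substitute into
      \<open>weq\<close>.\<close>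
    define k where "k v = (if v = u then \<gamma> / \<alpha> else if v = b' then - (\<gamma> / \<alpha> * \<beta>) else \<delta>)" for v
    have "card {u, b', b''} \<le> 2"
    proof (rule circ[OF _ w(1) ind])
      show "{u, b', b''} \<subseteq> U" using u bB B(2) by blast
      show "w = (\<Sum>t\<in>{u, b', b''}. k t *\<^sub>R t)"
        using dist ne nz unfolding weq by (simp add: k_def) (simp add: ueq algebra_simps)
      show "k t \<noteq> 0" if "t \<in> {u, b', b''}" for t
        using nz by (simp add: k_def)
    qed
    then show False using dist ne by simp
  qed
  define part where "part b = insert b {b'. link b b'}" for b
  have part_link: "part b = {b, b'}" if "link b b'" for b b'
    unfolding part_def using link_unique that by blast
  have part_cases: "part b = {b} \<or> (\<exists>b'. link b b' \<and> part b = {b, b'})" for b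
  proof (cases "\<exists>b'. link b b'")
    case False
    then show ?thesis by (simp add: part_def)
  qed (use part_link in blast)
  have part_eq: "part b = part c" if "c \<in> part b" for b c
    using part_cases[of b] part_link link_sym that by (metis empty_iff insert_commute insert_iff)
  show thesis
  proof (rule that[of "part ` B"])
    show "\<Union>(part ` B) = B" using link_B by (auto simp: part_def)
    show "disjoint (part ` B)"
      unfolding disjoint_def using part_eq by blast
    show "card P \<le> 2" if P: "P \<in> part ` B" for P
    proof -
      obtain b where "P = part b" using P by blast
      then show ?thesis using part_cases[of b] by (auto simp: card_insert_if)
    qed
    show "\<exists>P\<in>part ` B. u \<in> span P" if u: "u \<in> U" for u
    proof -
      have "\<exists>b\<in>B. S u \<subseteq> part b"
      proof (cases "card (S u) = 2")
        case True
        then obtain b b' where "S u = {b, b'}" "b \<noteq> b'" by (meson card_2_iff)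
        then have "link b b'" using u by (auto simp: link_def)
        then show ?thesis using part_link link_B \<open>S u = {b, b'}\<close> by blast
      next
        case False
        then have "card (S u) = 1"
          using Scard[OF u] Sne[OF u] finS[of u] by (metis One_nat_def card_0_eq le_SucE le_zero_eq numeral_2_eq_2)
        then obtain b where "S u = {b}" by (meson card_1_singletonE)
        then show ?thesis using SB[of u] by (auto simp: part_def)
      qed
      then obtain b where b: "b \<in> B" "S u \<subseteq> part b" by blast
      have "(\<Sum>b\<in>S u. r u b *\<^sub>R b) \<in> span (part b)"
        using b(2) by (intro span_sum span_scale span_base) blast
      then show ?thesis using b(1) rep[OF u] by auto
    qed
  qed
qed

section \<open>Splitting along the dual basis\<close>

text \<open>By \<open>mem\<close>, membership in \<open>L\<close> can be tested block by block, with
  a different witness in \<open>L\<close> for each block. Components of different points of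
  \<open>L\<close> may therefore be recombined, which is what makes \<open>L\<close> the sum of its
  components.\<close>

lemma two_decomposable_of_basis_partition:
  fixes L :: "'a::euclidean_space set"
  assumes B: "independent B" "span B = UNIV"
    and \<P>: "\<Union>\<P> = B" "disjoint \<P>" "\<And>P. P \<in> \<P> \<Longrightarrow> card P \<le> 2"
    and L: "compact_convex L"
    and mem: "\<And>y. (\<And>P. P \<in> \<P> \<Longrightarrow> \<exists>x\<in>L. \<forall>b\<in>P. b \<bullet> y = b \<bullet> x) \<Longrightarrow> y \<in> L"
  shows "two_decomposable L"
proof -
  have fin: "finite B" using B(1) independent_bound by blast
  then have "finite \<P>" using \<P>(1) finite_UnionD by blast
  then obtain p where p: "bij_betw p {..<card \<P>} \<P>"
    using ex_bij_betw_nat_finite[of \<P>] by (auto simp: atLeast0LessThan)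
  define m where "m = card \<P>"
  have pP: "p i \<in> \<P>" if "i < m" for i
    using bij_betwE[OF p] that by (simp add: m_def)
  have psurj: "\<exists>i<m. p i = P" if "P \<in> \<P>" for P
  proof -
    have "P \<in> p ` {..<m}" using bij_betw_imp_surj_on[OF p] that by (simp add: m_def)
    then show ?thesis by blast
  qed
  have pdisj: "p i \<inter> p j = {}" if "i < m" "j < m" "i \<noteq> j" for i j
  proof -
    have "p i \<noteq> p j" using inj_onD[OF bij_betw_imp_inj_on[OF p]] that by (auto simp: m_def)
    then show ?thesis using \<P>(2) pP that by (meson disjointD)
  qed
  have pB: "p i \<subseteq> B" if "i < m" for i using pP[OF that] \<P>(1) by blast
  have pfin: "finite (p i)" if "i < m" for i using pB[OF that] fin finite_subset by blast
  have Bp: "B = (\<Union>i\<in>{..<m}. p i)"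
    using \<P>(1) bij_betw_imp_surj_on[OF p] by (simp add: m_def)
  \<comment> \<open>The vectors \<open>d b\<close> for \<open>b\<close> in \<open>B\<close> form the
    dual basis; it spans the summands because the elements of \<open>B\<close> act as coordinate
    functionals.\<close>
  have "\<exists>d. \<forall>b'\<in>B. d \<bullet> b' = (if b' = b then 1 else 0)" for b
    using independent_inner_extend[OF B(1), of "\<lambda>b'. if b' = b then 1 else 0"] by metis
  then obtain d where d: "\<And>b b'. b' \<in> B \<Longrightarrow> d b \<bullet> b' = (if b' = b then 1 else 0)"
    by metis
  have sum_d: "(\<Sum>b\<in>A. f b *\<^sub>R d b) \<bullet> b' = (if b' \<in> A then f b' else 0)"
    if "A \<subseteq> B" "b' \<in> B" for A f b'
  proof -
    have "finite A" using that fin finite_subset by blast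
    have "(\<Sum>b\<in>A. f b *\<^sub>R d b) \<bullet> b' = (\<Sum>b\<in>A. if b' = b then f b else 0)"
      unfolding inner_sum_left by (rule sum.cong) (use d[OF that(2)] in auto)
    then show ?thesis using \<open>finite A\<close> by simp
  qed
  have ext: "x = y" if "\<And>b. b \<in> B \<Longrightarrow> x \<bullet> b = y \<bullet> b" for x y
  proof -
    have "orthogonal (x - y) (x - y)"
      by (rule orthogonal_to_span[of _ B]) (use that B(2) in \<open>auto simp: orthogonal_def inner_diff_left\<close>)
    then show ?thesis by (simp add: orthogonal_def)
  qed
  define \<xi> where "\<xi> i = span (d ` p i)" for i
  \<comment> \<open>The coordinates of \<open>x\<close> in the dual basis are
    \<open>x \<bullet> b\<close>, so this is its component in \<open>\<xi> i\<close>.\<close>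
  define \<pi> where "\<pi> i x = (\<Sum>b\<in>p i. (x \<bullet> b) *\<^sub>R d b)" for i x
  have \<pi>_\<xi>: "\<pi> i x \<in> \<xi> i" for i x
    unfolding \<pi>_def \<xi>_def by (intro span_sum span_scale span_base) blast
  have \<pi>_sum: "(\<Sum>i<m. \<pi> i x) = x" for x
  proof -
    have "(\<Sum>i<m. \<pi> i x) = (\<Sum>b\<in>B. (x \<bullet> b) *\<^sub>R d b)"
      unfolding \<pi>_def Bp by (rule sum.UNION_disjoint[symmetric]) (use pfin pdisj in auto)
    also have "\<dots> = x" by (rule ext) (simp add: sum_d)
    finally show ?thesis .
  qed
  have \<xi>_inner: "z \<bullet> b = 0" if "z \<in> \<xi> i" "i < m" "b \<in> B" "b \<notin> p i" for z i b
  proof -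
    have "orthogonal b z"
      by (rule orthogonal_to_span[OF that(1)[unfolded \<xi>_def]])
        (use that d in \<open>auto simp: orthogonal_def inner_commute\<close>)
    then show ?thesis by (simp add: orthogonal_def inner_commute)
  qed
  have sum_inner: "(\<Sum>j<m. v j) \<bullet> b = v i \<bullet> b" if v: "\<And>j. j < m \<Longrightarrow> v j \<in> \<xi> j" and i: "i < m" "b \<in> p i" for v i b
  proof -
    have "(\<Sum>j<m. v j) \<bullet> b = (\<Sum>j<m. if j = i then v i \<bullet> b else 0)"
      unfolding inner_sum_left
    proof (rule sum.cong[OF refl])
      fix j assume "j \<in> {..<m}"
      then show "v j \<bullet> b = (if j = i then v i \<bullet> b else 0)"
        using \<xi>_inner[OF v, of j b] pdisj[of i j] pB[OF i(1)] i by auto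
    qed
    then show ?thesis using i(1) by simp
  qed
  have \<pi>_unique: "v i = \<pi> i (\<Sum>j<m. v j)" if v: "\<And>j. j < m \<Longrightarrow> v j \<in> \<xi> j" and i: "i < m" for v i
  proof (rule ext)
    fix b assume b: "b \<in> B"
    show "v i \<bullet> b = \<pi> i (\<Sum>j<m. v j) \<bullet> b"
      unfolding \<pi>_def sum_d[OF pB[OF i] b]
      using sum_inner[OF v i] \<xi>_inner[OF v[OF i] i b] by auto
  qed
  have dsd: "direct_sum_decomposition m \<xi>"
    unfolding direct_sum_decomposition_def
  proof (intro conjI allI impI)
    show "subspace (\<xi> i)" for i by (simp add: \<xi>_def)
    show "\<exists>!v. v \<in> (\<Pi>\<^sub>E i\<in>{..<m}. \<xi> i) \<and> x = (\<Sum>i<m. v i)" for x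
    proof (rule ex1I[of _ "\<lambda>i\<in>{..<m}. \<pi> i x"])
      show "(\<lambda>i\<in>{..<m}. \<pi> i x) \<in> (\<Pi>\<^sub>E i\<in>{..<m}. \<xi> i) \<and> x = (\<Sum>i<m. (\<lambda>i\<in>{..<m}. \<pi> i x) i)"
        using \<pi>_\<xi> \<pi>_sum by auto
      fix v assume v: "v \<in> (\<Pi>\<^sub>E i\<in>{..<m}. \<xi> i) \<and> x = (\<Sum>i<m. v i)"
      then have "v i = \<pi> i x" if "i < m" for i
        using \<pi>_unique[of v i] that by auto
      then show "v = (\<lambda>i\<in>{..<m}. \<pi> i x)"
        using v by (auto simp: fun_eq_iff PiE_def extensional_def)
    qed
  qed
  have parts: "dim (\<xi> i) \<le> 2 \<and> compact_convex (\<pi> i ` L) \<and> \<pi> i ` L \<subseteq> \<xi> i" if i: "i < m" for i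
  proof (intro conjI)
    have "dim (\<xi> i) \<le> card (d ` p i)"
      unfolding \<xi>_def dim_span using pfin[OF i] by (intro dim_le_card') simp
    also have "\<dots> \<le> card (p i)" by (rule card_image_le[OF pfin[OF i]])
    also have "\<dots> \<le> 2" using \<P>(3) pP i by blast
    finally show "dim (\<xi> i) \<le> 2" .
    have lin: "linear (\<pi> i)"
      unfolding \<pi>_def
      by (rule linearI) (simp_all add: inner_add_left scaleR_add_left sum.distrib scaleR_sum_right)
    show "compact_convex (\<pi> i ` L)"
      using L unfolding compact_convex_def
      by (simp add: convex_linear_image[OF lin] compact_continuous_image linear_continuous_on
          linear_conv_bounded_linear[THEN iffD1, OF lin])
    show "\<pi> i ` L \<subseteq> \<xi> i" using \<pi>_\<xi> by blast
  qed
  have sum_L: "L = (\<Sum>i<m. \<pi> i ` L)"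
    unfolding set_sum_alt[OF finite_lessThan]
  proof (intro equalityI subsetI)
    fix x assume "x \<in> L"
    then show "x \<in> {sum s {..<m} |s. \<forall>i\<in>{..<m}. s i \<in> \<pi> i ` L}"
      using \<pi>_sum[of x] by (intro CollectI exI[of _ "\<lambda>i. \<pi> i x"]) auto
  next
    fix y assume "y \<in> {sum s {..<m} |s. \<forall>i\<in>{..<m}. s i \<in> \<pi> i ` L}"
    then obtain s where s: "y = sum s {..<m}" "\<forall>i\<in>{..<m}. s i \<in> \<pi> i ` L" by blast
    show "y \<in> L"
    proof (rule mem)
      fix P assume "P \<in> \<P>"
      then obtain i where i: "i < m" "p i = P" using psurj by blast
      then obtain x where x: "x \<in> L" "s i = \<pi> i x" using s(2) by blast
      \<comment> \<open>The other summands vanish on \<open>b\<close>, so on this block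
        \<open>y\<close> agrees with the point of \<open>L\<close> that supplied its summand
        \<open>s i\<close>.\<close>
      have "y \<bullet> b = x \<bullet> b" if b: "b \<in> p i" for b
      proof -
        have "y \<bullet> b = s i \<bullet> b"
          unfolding s(1)
        proof (rule sum_inner[OF _ i(1) b])
          fix j assume "j < m"
          then obtain x where "s j = \<pi> j x" using s(2) by blast
          then show "s j \<in> \<xi> j" using \<pi>_\<xi> by simp
        qed
        then show ?thesis
          unfolding x(2) \<pi>_def using sum_d[OF pB[OF i(1)]] pB[OF i(1)] b by auto
      qed
      then show "\<exists>x\<in>L. \<forall>b\<in>P. b \<bullet> y = b \<bullet> x"
        using x(1) i(2) by (auto simp: inner_commute)
    qed
  qed
  show ?thesis
    unfolding two_decomposable_def
    by (rule exI[of _ m], rule exI[of _ \<xi>], rule exI[of _ "\<lambda>i. \<pi> i ` L"])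
      (intro conjI dsd allI impI parts[THEN conjunct1] parts[THEN conjunct2, THEN conjunct1]
        parts[THEN conjunct2, THEN conjunct2] sum_L)
qed

text \<open>Regular normals decide membership in the cylinder, and \<open>W\<close> decides
  membership in \<open>L\<close> within it. Every regular normal lies in the span of a block, so
  agreement with \<open>L\<close> on each block suffices.\<close>

lemma two_reliable_imp_two_decomposable:
  fixes L :: "'a::euclidean_space set"
  assumes dim: "DIM('a) \<ge> 2" and L: "compact_convex L" "centrally_symmetric L" "two_reliable L"
  shows "two_decomposable L"
proof -
  define W where "W = normal_space L"
  define U where "U = {u. \<exists>x. regular_normal (cylinder L) x u}"
  obtain x0 where x0: "x0 \<in> L" using L(1) unfolding compact_convex_def by blast
  have UW: "u \<bullet> w = 0" if "u \<in> U" "w \<in> W" for u w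
    using that support_cylinder_orthogonal unfolding U_def W_def regular_normal_def by blast
  have below: "u \<bullet> y \<le> u \<bullet> x" if "regular_normal (cylinder L) x u" "y \<in> L" for u x y
    using that subset_cylinder[of L] unfolding regular_normal_def by blast
  \<comment> \<open>The witness in \<open>L\<close> may depend on \<open>u\<close>, since the
    half-spaces with regular normals cut out the cylinder one at a time.\<close>
  have cylI: "y \<in> cylinder L" if y: "\<And>u. u \<in> U \<Longrightarrow> \<exists>x\<in>L. u \<bullet> y = u \<bullet> x" for y
  proof (rule ccontr)
    assume "y \<notin> cylinder L"
    then obtain x u where xu: "regular_normal (cylinder L) x u" "u \<bullet> x < u \<bullet> y"
      using regular_normal_separates[OF closed_cylinder[OF L(1)] convex_cylinder[OF L(1)]
          interior_cylinder_nonempty[OF L(1)]] by blast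
    then obtain x' where "x' \<in> L" "u \<bullet> y = u \<bullet> x'" using y[of u] unfolding U_def by blast
    then show False using below[OF xu(1)] xu(2) by fastforce
  qed
  \<comment> \<open>A nonzero vector orthogonal to \<open>U\<close> and \<open>W\<close> would give
    a whole line through \<open>x0\<close> inside the bounded set \<open>L\<close>.\<close>
  have span_UW: "span (U \<union> W) = UNIV"
  proof (rule ccontr)
    assume "span (U \<union> W) \<noteq> UNIV"
    then obtain z where z: "z \<noteq> 0" "\<And>v. v \<in> span (U \<union> W) \<Longrightarrow> z \<bullet> v = 0"
      using span_not_UNIV_orthogonal by blast
    have "x0 + k *\<^sub>R z \<in> L" for k
    proof (rule mem_of_mem_cylinder[OF cylI x0])
      fix u assume "u \<in> U"
      then have "u \<bullet> z = 0" using z(2) by (simp add: inner_commute span_base)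
      then show "\<exists>x\<in>L. u \<bullet> (x0 + k *\<^sub>R z) = u \<bullet> x"
        using x0 by (intro bexI[of _ x0]) (auto simp: inner_add_right)
    next
      fix w assume "w \<in> normal_space L"
      then have "w \<in> W" by (simp add: W_def)
      then have "w \<bullet> z = 0" using z(2) by (simp add: inner_commute span_base)
      then show "w \<bullet> (x0 + k *\<^sub>R z) = w \<bullet> x0" by (simp add: inner_add_right)
    qed
    moreover have "bounded L"
      using L(1) compact_imp_bounded unfolding compact_convex_def by blast
    then obtain R where R: "\<And>x. x \<in> L \<Longrightarrow> norm x \<le> R"
      unfolding bounded_iff by blast
    ultimately have "norm (x0 + ((R + norm x0 + 1) / norm z) *\<^sub>R z) \<le> R" using R by blast
    moreover have "norm (((R + norm x0 + 1) / norm z) *\<^sub>R z) - norm x0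
        \<le> norm (x0 + ((R + norm x0 + 1) / norm z) *\<^sub>R z)"
      by (metis add.commute norm_diff_ineq)
    moreover have "norm (((R + norm x0 + 1) / norm z) *\<^sub>R z) = \<bar>R + norm x0 + 1\<bar>"
      using z(1) by simp
    ultimately show False by linarith
  qed
  obtain B1 where B1: "B1 \<subseteq> U" "independent B1" "U \<subseteq> span B1"
    using maximal_independent_subset[of U] by blast
  obtain \<P> where \<P>: "\<Union>\<P> = B1" "disjoint \<P>" "\<And>P. P \<in> \<P> \<Longrightarrow> card P \<le> 2"
    "\<And>u. u \<in> U \<Longrightarrow> \<exists>P\<in>\<P>. u \<in> span P"
  proof (rule small_circuits_partition[OF B1(2,1,3)])
    show "0 \<notin> U" by (simp add: U_def regular_normal_def)
    show "card T \<le> 2" if "T \<subseteq> U" "w \<in> U" "independent T" "w = (\<Sum>t\<in>T. k t *\<^sub>R t)"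
      "\<And>t. t \<in> T \<Longrightarrow> k t \<noteq> 0" for T w k
      by (rule two_reliable_circuit_bound[OF L dim that(3,4,5)]) (use that(1,2) in \<open>auto simp: U_def\<close>)
  qed blast
  \<comment> \<open>The normals in \<open>B1\<close> already span \<open>U\<close>, so the added
    vectors must come from \<open>W\<close>; they become singleton blocks.\<close>
  obtain B where B: "B1 \<subseteq> B" "B \<subseteq> U \<union> W" "independent B" "U \<union> W \<subseteq> span B"
    using maximal_independent_subset_extend[of B1 "U \<union> W"] B1 by blast
  have spanB: "span B = UNIV"
    using span_mono[OF B(4)] span_UW by (simp add: span_span top.extremum_uniqueI)
  have BW: "b \<in> W" if b: "b \<in> B - B1" for b
  proof (rule ccontr)
    assume "b \<notin> W"
    then have "b \<in> span B1" using b B(2) B1(3) by blast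
    then have "b \<in> span (B - {b})" using span_mono[of B1 "B - {b}"] B(1) b by blast
    then show False using B(3) b unfolding dependent_def by blast
  qed
  show ?thesis
  proof (rule two_decomposable_of_basis_partition[OF B(3) spanB, of "\<P> \<union> (\<lambda>b. {b}) ` (B - B1)"])
    show "\<Union>(\<P> \<union> (\<lambda>b. {b}) ` (B - B1)) = B" using \<P>(1) B(1) by auto
    show "disjoint (\<P> \<union> (\<lambda>b. {b}) ` (B - B1))"
      using \<P>(1,2) unfolding disjoint_def by blast
    show "card P \<le> 2" if "P \<in> \<P> \<union> (\<lambda>b. {b}) ` (B - B1)" for P
      using that \<P>(3) by auto
    show "compact_convex L" by (rule L(1))
    fix y assume y: "\<And>P. P \<in> \<P> \<union> (\<lambda>b. {b}) ` (B - B1) \<Longrightarrow> \<exists>x\<in>L. \<forall>b\<in>P. b \<bullet> y = b \<bullet> x"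
    have yU: "\<exists>x\<in>L. u \<bullet> y = u \<bullet> x" if u: "u \<in> U" for u
    proof -
      obtain P where P: "P \<in> \<P>" "u \<in> span P" using \<P>(4)[OF u] by blast
      obtain x where x: "x \<in> L" "\<forall>b\<in>P. b \<bullet> y = b \<bullet> x" using y[of P] P(1) by blast
      have "orthogonal (y - x) u"
        by (rule orthogonal_to_span[OF P(2)])
          (use x(2) in \<open>auto simp: orthogonal_def inner_diff_left inner_commute[of y] inner_commute[of x]\<close>)
      then have "u \<bullet> y = u \<bullet> x"
        by (simp add: orthogonal_def inner_commute[of _ u] inner_diff_right)
      then show ?thesis using x(1) by blast
    qed
    show "y \<in> L"
    proof -
      obtain l z where lz: "y = l + z" "l \<in> L" "z \<in> W"
        using cylI[OF yU] unfolding cylinder_def W_def by blast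
      \<comment> \<open>Regular normals are orthogonal to \<open>W\<close>. Any other basis vector
        is constant on \<open>L\<close>, and its singleton block forces \<open>y\<close> to take the
        same value.\<close>
      have "b \<bullet> z = 0" if b: "b \<in> B" for b
      proof (cases "b \<in> B1")
        case True
        then show ?thesis using UW B1(1) lz(3) by blast
      next
        case False
        then obtain x where x: "x \<in> L" "b \<bullet> y = b \<bullet> x" using y[of "{b}"] b by blast
        have "b \<in> normal_space L" using BW[of b] b False by (simp add: W_def)
        then have "b \<bullet> x = b \<bullet> l" using x(1) lz(2) by (rule inner_normal_space)
        then show ?thesis using x(2) lz(1) by (simp add: inner_add_right)
      qed
      then have "orthogonal z z"
        by (intro orthogonal_to_span[of z B]) (auto simp: spanB orthogonal_def inner_commute)
      then show ?thesis using lz by (simp add: orthogonal_def)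
    qed
  qed
qed

theorem theorem5p1:
  fixes L :: "(real ^ 'n) set"
  assumes "CARD('n) \<ge> 3"
    and "compact_convex L"
    and "centrally_symmetric L"
  shows "two_reliable L \<longleftrightarrow> two_decomposable L"
proof -
  have "DIM(real ^ 'n) \<ge> 2" using assms(1) by simp
  then show ?thesis
    using two_decomposable_imp_two_reliable two_reliable_imp_two_decomposable assms(2,3) by blast
qed

end
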